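(* Let $G$ be a connected $(P_7, C_4, \text{gem})$-free graph that has no clique cutset. If $G$ is not a clique blowup of the Petersen graph, then $G$ has a bisimplicial vertex.
   Context: All graphs are finite and simple. $P_t$, $C_t$ denote the path and cycle on $t$ vertices; $G$ is $H$-free if it has no induced subgraph isomorphic to $H$. A gem is the graph consisting of an induced $P_4$ plus a vertex adjacent to all four vertices of the $P_4$. A clique cutset of $G$ is a clique $K$ such that $G-K$ has more connected components than $G$. A clique blowup of a graph $H$ with $V(H)=\{v_1,\dots,v_n\}$ is any graph whose vertex set can be partitioned into $n$ nonempty cliques $A_1,\dots,A_n$ such that $A_i$ is complete to $A_j$ if $v_iv_j\in E(H)$ and $A_i$ is anticomplete to $A_j$ if $v_iv_j\notin E(H)$. A vertex is bisimplicial if its neighbourhood is the union of two cliques. *)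

theory Defs
  imports Main
begin

definition simple_graph :: "'a set \<Rightarrow> ('a \<Rightarrow> 'a \<Rightarrow> bool) \<Rightarrow> bool" where
  "simple_graph V E \<longleftrightarrow> finite V \<and> (\<forall>x y. E x y \<longrightarrow> x \<in> V \<and> y \<in> V)
     \<and> (\<forall>x y. E x y \<longrightarrow> E y x) \<and> (\<forall>x. \<not> E x x)"

definition induced_rel :: "'a set \<Rightarrow> ('a \<Rightarrow> 'a \<Rightarrow> bool) \<Rightarrow> 'a \<Rightarrow> 'a \<Rightarrow> bool" where
  "induced_rel S E = (\<lambda>x y. x \<in> S \<and> y \<in> S \<and> E x y)"

definition has_induced :: "'a set \<Rightarrow> ('a \<Rightarrow> 'a \<Rightarrow> bool) \<Rightarrow> 'b set \<Rightarrow> ('b \<Rightarrow> 'b \<Rightarrow> bool) \<Rightarrow> bool" where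
  "has_induced V E VH EH \<longleftrightarrow> (\<exists>f. inj_on f VH \<and> f ` VH \<subseteq> V \<and>
      (\<forall>x\<in>VH. \<forall>y\<in>VH. E (f x) (f y) \<longleftrightarrow> EH x y))"

definition H_free :: "'a set \<Rightarrow> ('a \<Rightarrow> 'a \<Rightarrow> bool) \<Rightarrow> 'b set \<Rightarrow> ('b \<Rightarrow> 'b \<Rightarrow> bool) \<Rightarrow> bool" where
  "H_free V E VH EH \<longleftrightarrow> \<not> has_induced V E VH EH"

definition path_V :: "nat \<Rightarrow> nat set" where "path_V t = {0..<t}"
definition path_E :: "nat \<Rightarrow> nat \<Rightarrow> nat \<Rightarrow> bool" where
  "path_E t i j \<longleftrightarrow> i < t \<and> j < t \<and> (i = j + 1 \<or> j = i + 1)"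

definition cycle_V :: "nat \<Rightarrow> nat set" where "cycle_V t = {0..<t}"
definition cycle_E :: "nat \<Rightarrow> nat \<Rightarrow> nat \<Rightarrow> bool" where
  "cycle_E t i j \<longleftrightarrow> i < t \<and> j < t \<and> i \<noteq> j \<and> (j = (i + 1) mod t \<or> i = (j + 1) mod t)"

definition gem_V :: "nat set" where "gem_V = {0..<5}"
definition gem_E :: "nat \<Rightarrow> nat \<Rightarrow> bool" where
  "gem_E i j \<longleftrightarrow> path_E 4 i j \<or> (i = 4 \<and> j < 4) \<or> (j = 4 \<and> i < 4)"

definition petersen_V :: "nat set set" where
  "petersen_V = {S. S \<subseteq> {0..<5} \<and> card S = 2}"
definition petersen_E :: "nat set \<Rightarrow> nat set \<Rightarrow> bool" where
  "petersen_E S T \<longleftrightarrow> S \<in> petersen_V \<and> T \<in> petersen_V \<and> S \<inter> T = {}"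

definition connected_graph :: "'a set \<Rightarrow> ('a \<Rightarrow> 'a \<Rightarrow> bool) \<Rightarrow> bool" where
  "connected_graph V E \<longleftrightarrow> V \<noteq> {} \<and> (\<forall>x\<in>V. \<forall>y\<in>V. (induced_rel V E)\<^sup>*\<^sup>* x y)"

definition components :: "'a set \<Rightarrow> ('a \<Rightarrow> 'a \<Rightarrow> bool) \<Rightarrow> 'a set set" where
  "components S E = (\<lambda>x. {y \<in> S. (induced_rel S E)\<^sup>*\<^sup>* x y}) ` S"

definition is_clique :: "'a set \<Rightarrow> ('a \<Rightarrow> 'a \<Rightarrow> bool) \<Rightarrow> 'a set \<Rightarrow> bool" where
  "is_clique V E K \<longleftrightarrow> K \<subseteq> V \<and> (\<forall>x\<in>K. \<forall>y\<in>K. x \<noteq> y \<longrightarrow> E x y)"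

definition clique_cutset :: "'a set \<Rightarrow> ('a \<Rightarrow> 'a \<Rightarrow> bool) \<Rightarrow> 'a set \<Rightarrow> bool" where
  "clique_cutset V E K \<longleftrightarrow> is_clique V E K \<and>
     card (components (V - K) E) > card (components V E)"

definition has_clique_cutset :: "'a set \<Rightarrow> ('a \<Rightarrow> 'a \<Rightarrow> bool) \<Rightarrow> bool" where
  "has_clique_cutset V E \<longleftrightarrow> (\<exists>K. clique_cutset V E K)"

definition clique_blowup :: "'a set \<Rightarrow> ('a \<Rightarrow> 'a \<Rightarrow> bool) \<Rightarrow> 'b set \<Rightarrow> ('b \<Rightarrow> 'b \<Rightarrow> bool) \<Rightarrow> bool" where
  "clique_blowup V E VH EH \<longleftrightarrow> (\<exists>A :: 'b \<Rightarrow> 'a set.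
     (\<forall>v\<in>VH. A v \<noteq> {} \<and> is_clique V E (A v)) \<and>
     (\<Union>v\<in>VH. A v) = V \<and>
     (\<forall>u\<in>VH. \<forall>v\<in>VH. u \<noteq> v \<longrightarrow> A u \<inter> A v = {}) \<and>
     (\<forall>u\<in>VH. \<forall>v\<in>VH. u \<noteq> v \<longrightarrow>
        (EH u v \<longrightarrow> (\<forall>x\<in>A u. \<forall>y\<in>A v. E x y)) \<and>
        (\<not> EH u v \<longrightarrow> (\<forall>x\<in>A u. \<forall>y\<in>A v. \<not> E x y))))"

definition nbhd :: "'a set \<Rightarrow> ('a \<Rightarrow> 'a \<Rightarrow> bool) \<Rightarrow> 'a \<Rightarrow> 'a set" where
  "nbhd V E v = {u \<in> V. E v u}"

definition bisimplicial :: "'a set \<Rightarrow> ('a \<Rightarrow> 'a \<Rightarrow> bool) \<Rightarrow> 'a \<Rightarrow> bool" where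
  "bisimplicial V E v \<longleftrightarrow> v \<in> V \<and>
     (\<exists>K1 K2. is_clique V E K1 \<and> is_clique V E K2 \<and> nbhd V E v = K1 \<union> K2)"

end

(*
Call an edge uv good if the common neighbours of u and v form a clique. The neighbourhood of a
vertex v induces a (P4, C4)-free graph, so if v is not bisimplicial, then any two good edges at v
leave room for a third one: v has a further good neighbour that is adjacent to neither of the two
given ends. Repeating this at every vertex of a P7-, C4- and gem-free graph without bisimplicial
vertices forces an induced Petersen graph after adding at most nine vertices to a good edge. This is
a finite case analysis, recorded as a refutation tree.

Given an induced Petersen graph P, a vertex outside P is either a twin of a vertex of P or its
neighbours in P form a clique, and in the latter case adjacent vertices have the same neighbours in
P. Hence the blowup H of P consisting of P and all twins is attached to each component of G - H along
a clique. This clique is a cutset, unless G = H.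
*)

theory Submission
  imports Defs
begin

subsection \<open>Refutation trees\<close>

text \<open>Goodness is what makes the branching step repeatable. If \<open>v s\<close> is good,
  then \<open>s\<close> and the neighbours of \<open>s\<close> inside the neighbourhood of
  \<open>v\<close> form a clique. Two such cliques cannot cover the neighbourhood of a vertex that
  is not bisimplicial, so some neighbour lies outside both, and a suitable choice of it is again
  good. Since goodness is symmetric, the step can be continued from the new end of the edge as well.
  \<open>P7\<close>-freeness enters only through leaves of the trees. Around a Petersen graph two
  devices keep the case analysis small. Permutations of five points move any vertex to
  \<open>{0, 1}\<close> and any nonadjacent pair to \<open>{0, 1}\<close>, \<open>{0, 2}\<close>.
  Replacing a vertex by a twin gives another induced Petersen graph, so facts about one copy extend
  to the whole blowup. The attachment of a component is a proper part of the blowup, because it is a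
  clique while the Petersen graph has nonadjacent vertices.\<close>

datatype name = u0 | u1 | u2 | u3 | u4 | u5 | u6 | u7 | u8 | u9 | u10 | u11

text \<open>A triple \<open>(x, ys, zs)\<close> says that \<open>x\<close> is adjacent to all of \<open>ys\<close> and to none of \<open>zs\<close>.\<close>

type_synonym 'n config = "('n \<times> 'n list \<times> 'n list) list"

text \<open>Each pair is recorded once, under the vertex named first. All pairs are decided, so the
  configuration describes an induced subgraph.\<close>

definition path7 :: "'n \<Rightarrow> 'n \<Rightarrow> 'n \<Rightarrow> 'n \<Rightarrow> 'n \<Rightarrow> 'n \<Rightarrow> 'n \<Rightarrow> 'n config" where
  "path7 a b c d e f g = [(a, [b], [c, d, e, f, g]), (b, [c], [d, e, f, g]), (c, [d], [e, f, g]),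
     (d, [e], [f, g]), (e, [f], [g]), (f, [g], [])]"

definition cycle4 :: "'n \<Rightarrow> 'n \<Rightarrow> 'n \<Rightarrow> 'n \<Rightarrow> 'n config" where
  "cycle4 a b c d = [(a, [b, d], [c]), (b, [c], [d]), (c, [d], [])]"

definition gem :: "'n \<Rightarrow> 'n \<Rightarrow> 'n \<Rightarrow> 'n \<Rightarrow> 'n \<Rightarrow> 'n config" where
  "gem a b c d e = [(a, [b, e], [c, d]), (b, [c, e], [d]), (c, [d, e], []), (d, [e], [])]"

text \<open>The ten vertices are the 2-subsets of \<open>{0..<5}\<close> in lexicographic order.\<close>

definition petersen :: "'n \<Rightarrow> 'n \<Rightarrow> 'n \<Rightarrow> 'n \<Rightarrow> 'n \<Rightarrow> 'n \<Rightarrow> 'n \<Rightarrow> 'n \<Rightarrow> 'n \<Rightarrow> 'n \<Rightarrow> 'n config" where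
  "petersen a b c d e f g h i j = [(a, [h, i, j], [b, c, d, e, f, g]), (b, [f, g, j], [c, d, e, h, i]),
     (c, [e, g, i], [d, f, h, j]), (d, [e, f, h], [g, i, j]), (e, [j], [f, g, h, i]),
     (f, [i], [g, h, j]), (g, [h], [i, j]), (h, [], [i, j]), (i, [], [j])]"

text \<open>Refutation trees. \<open>Split\<close> branches on the adjacency of two vertices. A leaf names a forbidden
  configuration among the known adjacencies, where \<open>Ban n\<close> refers to a list of configurations that are
  excluded by assumption. \<open>Claw v s t K y c\<close> uses that \<open>v\<close>, with good neighbours \<open>s\<close> and \<open>t\<close> (possibly equal),
  has another good neighbour not adjacent to \<open>s\<close> and \<open>t\<close>; \<open>K\<close> treats the cases that this vertex already
  has a name, and \<open>c\<close> the case that it is a new vertex \<open>y\<close>.\<close>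

datatype cert =
    Split name name cert cert
  | P7 name name name name name name name
  | C4 name name name name
  | Gem name name name name name
  | Pet name name name name name name name name name name
  | Ban nat
  | Claw name name name "(name \<times> cert) list" name cert

primrec row :: "'n config \<Rightarrow> 'n \<Rightarrow> 'n list \<times> 'n list" where
  "row [] x = ([], [])"
| "row (r # S) x = (if fst r = x then snd r else row S x)"

definition entails :: "'n config \<Rightarrow> 'n config \<Rightarrow> bool" where
  "entails S T \<longleftrightarrow> list_all (\<lambda>(x, ys, zs). case row S x of (ps, ns) \<Rightarrow>
     list_all (\<lambda>y. y \<in> set ps) ys \<and> list_all (\<lambda>z. z \<in> set ns) zs) T"

primrec put :: "'n \<Rightarrow> 'n \<Rightarrow> bool \<Rightarrow> 'n config \<Rightarrow> 'n config" where
  "put x y t [] = [if t then (x, [y], []) else (x, [], [y])]"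
| "put x y t (r # S) = (if fst r = x
     then (if t then (x, y # fst (snd r), snd (snd r)) else (x, fst (snd r), y # snd (snd r))) # S
     else r # put x y t S)"

definition add :: "'n \<Rightarrow> 'n \<Rightarrow> bool \<Rightarrow> 'n config \<Rightarrow> 'n config" where
  "add x y t S = put x y t (put y x t S)"

definition mem2 :: "'n \<Rightarrow> 'n \<Rightarrow> ('n \<times> 'n) list \<Rightarrow> bool" where
  "mem2 x y G \<longleftrightarrow> (x, y) \<in> set G \<or> (y, x) \<in> set G"

text \<open>\<open>D\<close> lists the names in use, \<open>S\<close> holds the known adjacencies in both directions (as \<open>entails\<close>
  looks only into the row of the first vertex), \<open>G\<close> the good edges. The flag \<open>p\<close> permits the rules
  \<open>Pet\<close> and \<open>Claw\<close>, which presuppose that there is neither a Petersen graph nor a bisimplicial vertex.\<close>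

fun check :: "bool \<Rightarrow> name config list \<Rightarrow> name list \<Rightarrow> name config \<Rightarrow> (name \<times> name) list \<Rightarrow> cert \<Rightarrow> bool" where
  "check p B D S G (Split a b c d) \<longleftrightarrow> a \<in> set D \<and> b \<in> set D \<and> a \<noteq> b \<and>
     check p B D (add a b True S) G c \<and> check p B D (add a b False S) G d"
| "check p B D S G (P7 a b c d e f g) \<longleftrightarrow> entails S (path7 a b c d e f g)"
| "check p B D S G (C4 a b c d) \<longleftrightarrow> entails S (cycle4 a b c d)"
| "check p B D S G (Gem a b c d e) \<longleftrightarrow> entails S (gem a b c d e)"
| "check p B D S G (Pet a b c d e f g h i j) \<longleftrightarrow> p \<and> entails S (petersen a b c d e f g h i j)"
| "check p B D S G (Ban n) \<longleftrightarrow> n < length B \<and> entails S (B ! n)"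
| "check p B D S G (Claw v s t K y c) \<longleftrightarrow> p \<and> v \<in> set D \<and> mem2 v s G \<and> mem2 v t G \<and> y \<notin> set D \<and>
     list_all (\<lambda>w. w \<in> {v, s, t} \<or> entails S [(w, [], [v])] \<or> entails S [(w, [s], [])]
        \<or> entails S [(w, [t], [])] \<or> w \<in> set (map fst K)) D \<and>
     list_all (\<lambda>(w, d). check p B D (add w v True (add w s False (add w t False S))) ((v, w) # G) d) K \<and>
     check p B (y # D) (add y v True (add y s False (add y t False S))) ((v, y) # G) c"

primrec names :: "'n config \<Rightarrow> 'n set" where
  "names [] = {}"
| "names (r # S) = insert (fst r) (set (fst (snd r)) \<union> set (snd (snd r)) \<union> names S)"

lemma names_put: "names (put x y t S) = {x, y} \<union> names S"
  by (induction S) auto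

lemma names_add: "names (add x y t S) = {x, y} \<union> names S"
  unfolding add_def names_put by blast

subsection \<open>The Petersen graph\<close>

lemma atLeastLessThan_5: "{0..<5::nat} = {0, 1, 2, 3, 4}"
  by auto

lemma petersen_V_pair: "{a, b} \<in> petersen_V \<longleftrightarrow> a < 5 \<and> b < 5 \<and> a \<noteq> b"
  by (auto simp: petersen_V_def card_insert_if)

lemma petersen_V_eq: "petersen_V = {{0, 1}, {0, 2}, {0, 3}, {0, 4}, {1, 2}, {1, 3}, {1, 4}, {2, 3}, {2, 4}, {3, 4}}"
proof
  show "petersen_V \<subseteq> {{0, 1}, {0, 2}, {0, 3}, {0, 4}, {1, 2}, {1, 3}, {1, 4}, {2, 3}, {2, 4}, {3, 4}}"
  proof
    fix S assume "S \<in> petersen_V"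
    then obtain a b where "S = {a, b}" "a \<noteq> b" "a \<in> {0..<5}" "b \<in> {0..<5}"
      unfolding petersen_V_def by (auto simp: card_2_iff)
    then show "S \<in> {{0, 1}, {0, 2}, {0, 3}, {0, 4}, {1, 2}, {1, 3}, {1, 4}, {2, 3}, {2, 4}, {3, 4}}"
      unfolding atLeastLessThan_5 by (elim insertE emptyE) (simp_all add: doubleton_eq_iff)
  qed
qed (auto simp: petersen_V_pair)

section \<open>Permutations of five points acting on the Petersen graph\<close>

definition perm5 :: "nat list \<Rightarrow> bool" where
  "perm5 l \<longleftrightarrow> distinct l \<and> set l = {0..<5}"

text \<open>Completes a few chosen points to a relabelling of all five.\<close>

lemma perm5_extend:
  assumes "distinct l" "set l \<subseteq> {0..<5}"
  shows "\<exists>m. perm5 (l @ m) \<and> length m = 5 - length l"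
proof -
  obtain m where m: "set m = {0..<5} - set l" "distinct m"
    using finite_distinct_list[of "{0..<5} - set l"] by blast
  then have "perm5 (l @ m)" using assms by (auto simp: perm5_def)
  moreover have "length (l @ m) = 5"
    using calculation distinct_card[of "l @ m"] by (auto simp: perm5_def)
  ultimately show ?thesis by (intro exI[of _ m]) auto
qed

lemma petersen_V_elem:
  assumes "S \<in> petersen_V" "a \<in> S"
  obtains b where "S = {a, b}" "a \<noteq> b" "a < 5" "b < 5"
proof -
  obtain p q where "S = {p, q}" "p \<noteq> q" "{p, q} \<subseteq> {0..<5}"
    using assms(1) unfolding petersen_V_def by (auto simp: card_2_iff)
  then show ?thesis using assms(2) that[of p] that[of q] by (auto simp: insert_commute)
qed

text \<open>Vertex transitivity in coordinates: read as a map on indices, the list sends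
  \<open>{0, 1}\<close> to \<open>S\<close>.\<close>

lemma petersen_V_obtain:
  assumes "S \<in> petersen_V"
  obtains a b c d e where "S = {a, b}" "perm5 [a, b, c, d, e]"
proof -
  obtain a b where S: "S = {a, b}" "a \<noteq> b" "{a, b} \<subseteq> {0..<5}"
    using assms unfolding petersen_V_def by (auto simp: card_2_iff)
  then obtain m where "perm5 ([a, b] @ m)" "length m = 3" using perm5_extend[of "[a, b]"] by auto
  then show ?thesis using that[of a b] S by (auto simp: length_Suc_conv numeral_eq_Suc)
qed

text \<open>Distinct 2-subsets that meet are the nonadjacent pairs. They share exactly one point, so
  the list sends \<open>{0, 1}\<close> and \<open>{0, 2}\<close> to them.\<close>

lemma petersen_V_meet:
  assumes "S \<in> petersen_V" "T \<in> petersen_V" "S \<noteq> T" "S \<inter> T \<noteq> {}"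
  obtains a b c d e where "S = {a, b}" "T = {a, c}" "perm5 [a, b, c, d, e]"
proof -
  obtain a where a: "a \<in> S" "a \<in> T" using assms by blast
  obtain b c where S: "S = {a, b}" "a \<noteq> b" "T = {a, c}" "a \<noteq> c" "a < 5" "b < 5" "c < 5"
    using petersen_V_elem[OF assms(1) a(1)] petersen_V_elem[OF assms(2) a(2)] by metis
  moreover have "b \<noteq> c" using S assms(3) by blast
  ultimately obtain m where "perm5 ([a, b, c] @ m)" "length m = 2"
    using perm5_extend[of "[a, b, c]"] by auto
  then show ?thesis using that[of a b c] S by (auto simp: length_Suc_conv numeral_eq_Suc)
qed

text \<open>These pairs are the edges. The fifth point gives vertices such as \<open>{a, e}\<close>,
  adjacent to \<open>T\<close> but not to \<open>S\<close>.\<close>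

lemma petersen_V_disjoint:
  assumes "S \<in> petersen_V" "T \<in> petersen_V" "S \<inter> T = {}"
  obtains a b c d e where "S = {a, b}" "T = {c, d}" "perm5 [a, b, c, d, e]"
proof -
  obtain a b where S: "S = {a, b}" "a \<noteq> b" "{a, b} \<subseteq> {0..<5}"
    using assms(1) unfolding petersen_V_def by (auto simp: card_2_iff)
  moreover obtain c d where T: "T = {c, d}" "c \<noteq> d" "{c, d} \<subseteq> {0..<5}"
    using assms(2) unfolding petersen_V_def by (auto simp: card_2_iff)
  ultimately obtain m where "perm5 ([a, b, c, d] @ m)" "length m = 1"
    using perm5_extend[of "[a, b, c, d]"] assms by auto
  then show ?thesis using that[of a b c d] S T by (auto simp: length_Suc_conv numeral_eq_Suc)
qed

lemma perm5_less: "perm5 l \<Longrightarrow> x \<in> set l \<Longrightarrow> x < 5"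
  by (auto simp: perm5_def)

lemma perm5_nth_image:
  assumes "perm5 [a, b, c, d, e]"
  defines "s \<equiv> (!) [a, b, c, d, e]"
  shows "inj_on s {0..<5}" "s ` {0..<5} = {0..<5}"
proof -
  show "inj_on s {0..<5}"
    using assms by (auto simp: perm5_def inj_on_def nth_eq_iff_index_eq)
  show "s ` {0..<5} = {0..<5}"
    using assms by (auto simp: perm5_def atLeastLessThan_5)
qed

lemma petersen_V_image:
  assumes s: "inj_on s {0..<5}" "s ` {0..<5} = {0..<5}" and S: "S \<in> petersen_V"
  shows "s ` S \<in> petersen_V"
proof -
  have sub: "S \<subseteq> {0..<5}" and card: "card S = 2" using S unfolding petersen_V_def by blast+
  have "card (s ` S) = 2" using card_image[OF inj_on_subset[OF s(1) sub]] card by simp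
  moreover have "s ` S \<subseteq> {0..<5}" using image_mono[OF sub, of s] s(2) by simp
  ultimately show ?thesis unfolding petersen_V_def by blast
qed

lemma perm5D:
  assumes "perm5 [a, b, c, d, e]"
  shows "a < 5 \<and> b < 5 \<and> c < 5 \<and> d < 5 \<and> e < 5" "distinct [a, b, c, d, e]"
proof -
  show "a < 5 \<and> b < 5 \<and> c < 5 \<and> d < 5 \<and> e < 5" using perm5_less[OF assms] by simp
  show "distinct [a, b, c, d, e]" using assms unfolding perm5_def by blast
qed

section \<open>Refutation trees for vertices attached to an induced Petersen graph\<close>

definition petersen_rows :: "name config" where
  "petersen_rows = [
    (u0, [u7, u8, u9], [u1, u2, u3, u4, u5, u6]),
    (u1, [u5, u6, u9], [u0, u2, u3, u4, u7, u8]),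
    (u2, [u4, u6, u8], [u0, u1, u3, u5, u7, u9]),
    (u3, [u4, u5, u7], [u0, u1, u2, u6, u8, u9]),
    (u4, [u2, u3, u9], [u0, u1, u5, u6, u7, u8]),
    (u5, [u1, u3, u8], [u0, u2, u4, u6, u7, u9]),
    (u6, [u1, u2, u7], [u0, u3, u4, u5, u8, u9]),
    (u7, [u0, u3, u6], [u1, u2, u4, u5, u8, u9]),
    (u8, [u0, u2, u5], [u1, u3, u4, u6, u7, u9]),
    (u9, [u0, u1, u4], [u2, u3, u5, u6, u7, u8])]"

text \<open>\<open>u0\<close>, \<open>u1\<close>, \<open>u4\<close>, \<open>u9\<close> form the
  closed neighbourhood of \<open>u9\<close>, the common neighbour of \<open>u0\<close> and
  \<open>u1\<close>; so \<open>u10\<close> is a twin of \<open>u9\<close>.\<close>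

definition twin_config :: "name config" where
  "twin_config = [(u10, [u0, u1, u4, u9], [u2, u3, u5, u6, u7, u8])]"

text \<open>Each entry gives \<open>u10\<close> or \<open>u11\<close> two nonadjacent neighbours in
  the Petersen graph. The order matters, as \<open>Ban n\<close> refers to positions.\<close>

definition clique_configs :: "name config list" where
  "clique_configs = [
    [(u10, [u0, u1], [])], [(u10, [u0, u2], [])], [(u10, [u0, u3], [])], [(u10, [u0, u4],
     [])], [(u10, [u0, u5], [])], [(u10, [u0, u6], [])], [(u11, [u2, u7], [])], [(u11, [u4,
     u7], [])], [(u11, [u7, u8], [])], [(u10, [u7, u8], [])], [(u11, [u1, u3], [])], [(u11,
     [u2, u3], [])], [(u11, [u3, u6], [])], [(u11, [u4, u6], [])], [(u11, [u5, u6], [])],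
     [(u10, [u8, u9], [])], [(u11, [u1, u8], [])], [(u11, [u1, u2], [])], [(u11, [u2, u5],
     [])], [(u11, [u1, u4], [])]]"

text \<open>Without the edge \<open>u9 u10\<close> there is a \<open>C4\<close> on
  \<open>u9\<close>, \<open>u0\<close>, \<open>u10\<close>, \<open>u1\<close>. With it, every way to
  attach \<open>u10\<close> to the other seven vertices gives a \<open>C4\<close>, a gem or a
  \<open>P7\<close>, except that of a twin of \<open>u9\<close>.\<close>

definition clique_cert :: cert where
  "clique_cert =
    (Split u9 u10 (Split u5 u10 (Gem u5 u1 u9 u0 u10) (Split u3 u10 (C4 u3 u10 u1 u5) (Split u8 u10 (C4
    u8 u10 u1 u5) (Split u2 u10 (C4 u2 u10 u0 u8) (Split u6 u10 (Gem u6 u1 u9 u0 u10) (Split u7 u10 (C4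
    u7 u10 u1 u6) (Split u4 u10 (Ban 0) (P7 u0 u10 u1 u5 u3 u4 u2)))))))) (C4 u9 u0 u10 u1))"

text \<open>\<open>u1\<close> to \<open>u6\<close> are not adjacent to \<open>u0\<close>, so
  \<open>u10\<close> misses them all (\<open>Ban 0\<close> to \<open>Ban 5\<close>). What remains is
  to branch on the neighbours of \<open>u11\<close> and on the edges from \<open>u10\<close> to
  \<open>u7\<close>, \<open>u8\<close>, \<open>u9\<close>.\<close>

definition transfer_cert :: cert where
  "transfer_cert =
    (Split u1 u10 (Ban 0) (Split u2 u10 (Ban 1) (Split u3 u10 (Ban 2) (Split u4 u10 (Ban 3) (Split u5
    u10 (Ban 4) (Split u6 u10 (Ban 5) (Split u7 u11 (Split u2 u11 (Ban 6) (Split u4 u11 (Ban 7) (Split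
    u8 u11 (Ban 8) (Split u7 u10 (Split u8 u10 (Ban 9) (Split u3 u11 (Gem u0 u10 u11 u3 u7) (P7 u3 u4 u2
    u8 u0 u10 u11))) (C4 u7 u0 u10 u11))))) (Split u3 u11 (Split u1 u11 (Ban 10) (Split u2 u11 (Ban 11)
    (Split u6 u11 (Ban 12) (Split u4 u11 (P7 u0 u10 u11 u4 u2 u6 u1) (P7 u0 u10 u11 u3 u4 u2 u6)))))
    (Split u6 u11 (Split u4 u11 (Ban 13) (Split u5 u11 (Ban 14) (Split u1 u11 (P7 u0 u10 u11 u1 u5 u3
    u4) (P7 u0 u10 u11 u6 u1 u5 u3)))) (Split u8 u10 (Split u7 u10 (Ban 9) (Split u9 u10 (Ban 15) (Split
    u9 u11 (C4 u9 u11 u10 u0) (Split u8 u11 (Split u1 u11 (Ban 16) (Split u2 u11 (Gem u0 u10 u11 u2 u8)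
    (P7 u2 u6 u1 u9 u0 u10 u11))) (Split u2 u11 (C4 u2 u11 u10 u8) (P7 u3 u7 u6 u2 u8 u10 u11))))))
    (Split u8 u11 (C4 u8 u11 u10 u0) (Split u2 u11 (Split u1 u11 (Ban 17) (Split u5 u11 (Ban 18) (P7 u0
    u10 u11 u2 u6 u1 u5))) (Split u1 u11 (Split u4 u11 (Ban 19) (P7 u0 u10 u11 u1 u6 u2 u4)) (P7 u1 u6
    u2 u8 u0 u10 u11))))))))))))))"

lemma clique_check:
  "check False [twin_config] [u0, u1, u2, u3, u4, u5, u6, u7, u8, u9, u10]
     (add u10 u0 True (add u10 u1 True petersen_rows)) [] clique_cert"
  by code_simp

lemma transfer_check:
  "check False clique_configs [u0, u1, u2, u3, u4, u5, u6, u7, u8, u9, u10, u11]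
     (add u10 u0 True (add u11 u0 False (add u10 u11 True petersen_rows))) [] transfer_cert"
  by code_simp

subsection \<open>Good edges\<close>

locale forbidding =
  fixes V :: "'a set" and E :: "'a \<Rightarrow> 'a \<Rightarrow> bool"
  assumes simple: "simple_graph V E"
    and P7_free: "H_free V E (path_V 7) (path_E 7)"
    and C4_free: "H_free V E (cycle_V 4) (cycle_E 4)"
    and gem_free: "H_free V E gem_V gem_E"
begin

lemma fin: "finite V" and edge_V: "E x y \<Longrightarrow> x \<in> V \<and> y \<in> V"
  and sym: "E x y \<Longrightarrow> E y x" and irrefl: "\<not> E x x"
  using simple unfolding simple_graph_def by blast+

lemma edge_commute: "E x y \<longleftrightarrow> E y x"
  using sym by blast

text \<open>Distinctness is part of the condition because an induced copy must be injective, while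
  \<open>f\<close> itself need not be.\<close>

definition holds :: "('n \<Rightarrow> 'a) \<Rightarrow> 'n config \<Rightarrow> bool" where
  "holds f S \<longleftrightarrow> (\<forall>(x, ys, zs) \<in> set S. (\<forall>y \<in> set ys. f x \<noteq> f y \<and> E (f x) (f y))
     \<and> (\<forall>z \<in> set zs. f x \<noteq> f z \<and> \<not> E (f x) (f z)))"

text \<open>Symmetry and irreflexivity of both relations reduce the embedding to pairs
  \<open>i < j\<close>; for an explicit list \<open>w\<close> the bounded quantifiers unfold to
  finitely many facts.\<close>

lemma has_induced_list:
  assumes adj: "\<forall>j<length w. \<forall>i<j. w ! i \<noteq> w ! j \<and> (E (w ! i) (w ! j) \<longleftrightarrow> H i j)"
    and w: "set w \<subseteq> V" and H: "\<And>i j. H i j \<longleftrightarrow> H j i" "\<And>i. \<not> H i i"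
  shows "has_induced V E {0..<length w} H"
  unfolding has_induced_def
proof (intro exI conjI ballI)
  show "inj_on ((!) w) {0..<length w}"
    using adj by (auto simp: inj_on_def nth_eq_iff_index_eq) (metis linorder_neqE_nat)
  show "(!) w ` {0..<length w} \<subseteq> V" using w by (auto dest: nth_mem)
  show "E (w ! x) (w ! y) \<longleftrightarrow> H x y" if "x \<in> {0..<length w}" "y \<in> {0..<length w}" for x y
  proof (cases x y rule: linorder_cases)
    case less
    then show ?thesis using that adj by auto
  next
    case equal
    then show ?thesis using irrefl H(2) by simp
  next
    case greater
    then show ?thesis using that adj edge_commute[of "w ! x" "w ! y"] H(1)[of x y] by auto
  qed
qed

lemma no_path7: "\<not> holds f (path7 a b c d e g h)"
proof
  assume *: "holds f (path7 a b c d e g h)"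
  have "has_induced V E {0..<length [f a, f b, f c, f d, f e, f g, f h]} (path_E 7)"
    using * by (intro has_induced_list)
      (auto simp: holds_def path7_def path_E_def All_less_Suc numeral_eq_Suc dest: edge_V)
  then show False using P7_free unfolding H_free_def path_V_def by (simp add: numeral_eq_Suc)
qed

lemma no_cycle4: "\<not> holds f (cycle4 a b c d)"
proof
  assume *: "holds f (cycle4 a b c d)"
  \<comment> \<open>Replaces \<open>mod\<close> by the one wrap-around pair, so that only numerals
    are compared.\<close>
  have cyc: "cycle_E 4 = (\<lambda>i j. i < 4 \<and> j < 4 \<and> (i = j + 1 \<or> j = i + 1 \<or> i = 0 \<and> j = 3 \<or> i = 3 \<and> j = 0))"
    by (intro ext) (auto simp: cycle_E_def mod_Suc)
  have "has_induced V E {0..<length [f a, f b, f c, f d]} (cycle_E 4)"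
    unfolding cyc using * by (intro has_induced_list)
      (auto simp: holds_def cycle4_def All_less_Suc numeral_eq_Suc dest: edge_V)
  then show False using C4_free unfolding H_free_def cycle_V_def by (simp add: numeral_eq_Suc)
qed

lemma no_gem: "\<not> holds f (gem a b c d e)"
proof
  assume *: "holds f (gem a b c d e)"
  have "has_induced V E {0..<length [f a, f b, f c, f d, f e]} gem_E"
    using * by (intro has_induced_list)
      (auto simp: holds_def gem_def gem_E_def path_E_def All_less_Suc numeral_eq_Suc dest: edge_V)
  then show False using gem_free unfolding H_free_def gem_V_def by (simp add: numeral_eq_Suc)
qed

lemma C4_chord: "E a b \<Longrightarrow> E b c \<Longrightarrow> E c d \<Longrightarrow> E d a \<Longrightarrow> a \<noteq> c \<Longrightarrow> b \<noteq> d \<Longrightarrow> \<not> E a c \<Longrightarrow> E b d"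
  using no_cycle4[of id a b c d] irrefl by (auto simp: holds_def cycle4_def edge_commute)

text \<open>The neighbourhood of \<open>e\<close> has no induced \<open>P4\<close>, so a path in it
  that lacks both short chords has the long one.\<close>

lemma gem_chord: "E a b \<Longrightarrow> E b c \<Longrightarrow> E c d \<Longrightarrow> E e a \<Longrightarrow> E e b \<Longrightarrow> E e c \<Longrightarrow> E e d
    \<Longrightarrow> \<not> E a c \<Longrightarrow> \<not> E b d \<Longrightarrow> E a d"
  using no_gem[of id a b c d e] irrefl by (auto simp: holds_def gem_def edge_commute)

definition good :: "'a \<Rightarrow> 'a \<Rightarrow> bool" where
  "good u v \<longleftrightarrow> E u v \<and> (\<forall>x y. E u x \<and> E v x \<and> E u y \<and> E v y \<and> x \<noteq> y \<longrightarrow> E x y)"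

lemma good_commute: "good u v \<longleftrightarrow> good v u"
  unfolding good_def using edge_commute by blast

text \<open>Among the neighbours of \<open>v\<close> outside the closed neighbourhoods of \<open>S\<close>, one with the fewest common
  neighbours with \<open>v\<close> works, since the neighbourhood of \<open>v\<close> induces a \<open>P\<^sub>4\<close>- and \<open>C\<^sub>4\<close>-free graph.\<close>

lemma ex_good_outside:
  assumes S: "\<And>s. s \<in> S \<Longrightarrow> good v s"
    and x0: "E v x0" "x0 \<notin> S" "\<And>s. s \<in> S \<Longrightarrow> \<not> E x0 s"
  shows "\<exists>x. good v x \<and> x \<notin> S \<and> (\<forall>s\<in>S. \<not> E x s)"
proof -
  define P where "P x \<longleftrightarrow> E v x \<and> x \<notin> S \<and> (\<forall>s\<in>S. \<not> E x s)" for x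
  define N where "N x = {y. E v y \<and> E x y}" for x
  have finN: "finite (N x)" for x
    by (rule finite_subset[OF _ fin]) (auto simp: N_def dest: edge_V)
  obtain x where x: "P x" and min: "\<And>y. P y \<Longrightarrow> card (N x) \<le> card (N y)"
    using ex_has_least_nat[of P x0 "\<lambda>x. card (N x)"] x0 unfolding P_def by blast
  \<comment> \<open>A nonadjacent pair \<open>y\<close>, \<open>z\<close> would make
    \<open>y\<close> a better choice than \<open>x\<close>.\<close>
  have "E y z" if yz: "E v y" "E x y" "E v z" "E x z" "y \<noteq> z" for y z
  proof (rule ccontr)
    assume n: "\<not> E y z"
    \<comment> \<open>An \<open>s\<close> adjacent to \<open>y'\<close> either sees
      \<open>z'\<close> too and gives a \<open>C4\<close> with \<open>y'\<close>, \<open>x\<close>,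
      \<open>z'\<close>, or extends \<open>z'\<close>, \<open>x\<close>, \<open>y'\<close> to an
      induced \<open>P4\<close> in the neighbourhood of \<open>v\<close>, a gem.\<close>
    have Py: "P y'" if y': "E v y'" "E x y'" "E v z'" "E x z'" "y' \<noteq> z'" "\<not> E y' z'" for y' z'
    proof -
      have vx: "E v x" using x P_def by simp
      have False if s: "s \<in> S" "y' = s \<or> E y' s" for s
      proof -
        have sx: "E v s" using S[OF s(1)] unfolding good_def by blast
        have xs: "\<not> E x s" "s \<noteq> x" using x s(1) unfolding P_def by blast+
        have ys: "E y' s" using s(2) y'(2) xs(1) by blast
        show False
        proof (cases "E z' s")
          case True
          have "E x s"
            using C4_chord[of y' x z' s] y' ys True xs sym by blast
          then show False using xs by simp
        next
          case False
          have "E z' s"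
            using gem_chord[of z' x y' s v] y' ys sx xs vx sym by blast
          then show False using False by simp
        qed
      qed
      then show "P y'" using y' unfolding P_def by blast
    qed
    have vx: "E v x" using x P_def by simp
    \<comment> \<open>From \<open>x\<close> to \<open>y\<close> the set gains at most
      \<open>x\<close> and loses both \<open>y\<close> and \<open>z\<close>. A neighbour
      \<open>t\<close> of \<open>y\<close> that misses \<open>x\<close> would give a
      \<open>C4\<close> if it sees \<open>z\<close>, and a gem if not.\<close>
    have "N y \<subseteq> insert x (N x - {y, z})"
    proof
      fix t assume "t \<in> N y"
      then have t: "E v t" "E y t" by (auto simp: N_def)
      have "t \<noteq> y" using t irrefl by blast
      moreover have "t \<noteq> z" using t n by blast
      moreover have "E x t" if "t \<noteq> x"
      proof (rule ccontr)
        assume nt: "\<not> E x t"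
        show False
        proof (cases "E z t")
          case True
          then show False using C4_chord[of y x z t] yz t nt that n sym by blast
        next
          case False
          then show False using gem_chord[of z x y t v] yz t nt vx n sym by blast
        qed
      qed
      ultimately show "t \<in> insert x (N x - {y, z})" using t by (auto simp: N_def)
    qed
    then have "card (N y) \<le> card (insert x (N x - {y, z}))"
      using finN by (intro card_mono) auto
    also have "\<dots> \<le> Suc (card (N x - {y, z}))" by (rule card_insert_le_m1[simplified]) (auto simp: finN card_insert_if)
    also have "card (N x - {y, z}) = card (N x) - card {y, z}"
      using yz by (intro card_Diff_subset) (auto simp: N_def)
    also have "card {y, z} = 2" using yz by simp
    finally have "card (N y) \<le> Suc (card (N x) - 2)" .
    \<comment> \<open>Ensures that the truncated subtraction of 2 on \<open>nat\<close> is a true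
      one.\<close>
    moreover have "card {y, z} \<le> card (N x)"
      using yz finN by (intro card_mono) (auto simp: N_def)
    moreover have "card {y, z} = 2" using yz by simp
    moreover have "card (N x) \<le> card (N y)"
      using min[OF Py[of y z]] yz n by blast
    ultimately show False by linarith
  qed
  then show ?thesis using x unfolding P_def good_def by blast
qed

text \<open>A vertex without neighbours is bisimplicial through two empty cliques; otherwise the
  minimal choice with \<open>S\<close> empty applies.\<close>

lemma ex_good:
  assumes "v \<in> V" "\<not> bisimplicial V E v"
  shows "\<exists>x. good v x"
proof -
  have "nbhd V E v \<noteq> {}"
    using assms unfolding bisimplicial_def is_clique_def by blast
  then obtain x0 where "E v x0" unfolding nbhd_def by blast
  then show ?thesis using ex_good_outside[of "{}" v x0] by auto
qed

lemma ex_third_good: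
  assumes nb: "\<not> bisimplicial V E v" and s: "good v s" and t: "good v t"
  shows "\<exists>x. good v x \<and> x \<noteq> s \<and> x \<noteq> t \<and> \<not> E x s \<and> \<not> E x t"
proof -
  \<comment> \<open>Goodness of \<open>v s\<close> makes this set a clique; if the sets for
    \<open>s\<close> and \<open>t\<close> covered the neighbourhood of \<open>v\<close>, then
    \<open>v\<close> would be bisimplicial.\<close>
  have cl: "is_clique V E {x. E v x \<and> (x = s \<or> E x s)}" if "good v s" for s
    unfolding is_clique_def using that edge_commute edge_V unfolding good_def by blast
  have "\<exists>x0. E v x0 \<and> x0 \<notin> {s, t} \<and> \<not> E x0 s \<and> \<not> E x0 t"
  proof (rule ccontr)
    assume "\<not> ?thesis"
    then have "nbhd V E v = {x. E v x \<and> (x = s \<or> E x s)} \<union> {x. E v x \<and> (x = t \<or> E x t)}"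
      unfolding nbhd_def using edge_V by blast
    moreover have "v \<in> V" using s edge_V unfolding good_def by blast
    ultimately show False using nb cl[OF s] cl[OF t] unfolding bisimplicial_def by blast
  qed
  then obtain x0 where "E v x0" "x0 \<notin> {s, t}" "\<not> E x0 s" "\<not> E x0 t" by blast
  then show ?thesis using ex_good_outside[of "{s, t}" v x0] s t by auto
qed

subsection \<open>Soundness of refutation trees\<close>

lemma holds_Cons: "holds f ((x, ys, zs) # S) \<longleftrightarrow> (\<forall>y \<in> set ys. f x \<noteq> f y \<and> E (f x) (f y))
    \<and> (\<forall>z \<in> set zs. f x \<noteq> f z \<and> \<not> E (f x) (f z)) \<and> holds f S"
  by (auto simp: holds_def)

lemma holds_Nil: "holds f []"
  by (simp add: holds_def)

lemma holds_cong: "(\<And>x. x \<in> names S \<Longrightarrow> f x = g x) \<Longrightarrow> holds f S \<longleftrightarrow> holds g S"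
proof (induction S)
  case (Cons r S)
  then show ?case by (cases r) (simp add: holds_Cons)
qed (simp add: holds_Nil)

lemma holds_put:
  "holds f S \<Longrightarrow> f x \<noteq> f y \<Longrightarrow> E (f x) (f y) \<longleftrightarrow> t \<Longrightarrow> holds f (put x y t S)"
  by (induction S) (auto simp: holds_def)

lemma holds_add:
  "holds f S \<Longrightarrow> f x \<noteq> f y \<Longrightarrow> E (f x) (f y) \<longleftrightarrow> t \<Longrightarrow> holds f (add x y t S)"
  using holds_put[of f "put y x t S" x y t] holds_put[of f S y x t] edge_commute[of "f x" "f y"]
  unfolding add_def by auto

lemma holds_row:
  assumes "holds f S" "row S x = (ps, ns)"
  shows "\<forall>y \<in> set ps. f x \<noteq> f y \<and> E (f x) (f y)" "\<forall>z \<in> set ns. f x \<noteq> f z \<and> \<not> E (f x) (f z)"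
  using assms by (induction S) (auto simp: holds_def split: if_splits)

lemma entails_holds:
  assumes T: "entails S T" and S: "holds f S"
  shows "holds f T"
  unfolding holds_def
proof (intro ballI, clarify)
  fix x ys zs assume mem: "(x, ys, zs) \<in> set T"
  obtain ps ns where row: "row S x = (ps, ns)" by fastforce
  have "set ys \<subseteq> set ps" "set zs \<subseteq> set ns"
    using T mem row unfolding entails_def list_all_iff by fastforce+
  then show "(\<forall>y\<in>set ys. f x \<noteq> f y \<and> E (f x) (f y)) \<and> (\<forall>z\<in>set zs. f x \<noteq> f z \<and> \<not> E (f x) (f z))"
    using holds_row[OF S row] by blast
qed

text \<open>Injectivity on \<open>D\<close> supplies the distinctness that \<open>holds\<close>
  demands whenever an adjacency is added.\<close>

definition model :: "('n \<Rightarrow> 'a) \<Rightarrow> 'n list \<Rightarrow> 'n config \<Rightarrow> ('n \<times> 'n) list \<Rightarrow> bool" where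
  "model f D S G \<longleftrightarrow> inj_on f (set D) \<and> names S \<subseteq> set D \<and> set G \<subseteq> set D \<times> set D
     \<and> holds f S \<and> (\<forall>(a, b) \<in> set G. good (f a) (f b))"

lemma model_mem2: "model f D S G \<Longrightarrow> mem2 a b G \<Longrightarrow> a \<in> set D \<and> b \<in> set D \<and> good (f a) (f b)"
  unfolding model_def mem2_def using good_commute by fast

lemma model_add:
  assumes "model f D S G" "a \<in> set D" "b \<in> set D" "a \<noteq> b" "E (f a) (f b) \<longleftrightarrow> t"
  shows "model f D (add a b t S) G"
proof -
  have "f a \<noteq> f b" using assms unfolding model_def inj_on_def by blast
  then show ?thesis using assms holds_add[of f S a b t] unfolding model_def by (auto simp: names_add)
qed

lemma model_good:
  "model f D S G \<Longrightarrow> a \<in> set D \<Longrightarrow> b \<in> set D \<Longrightarrow> good (f a) (f b) \<Longrightarrow> model f D S ((a, b) # G)"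
  unfolding model_def by auto

lemma model_new:
  assumes m: "model f D S G" and y: "y \<notin> set D" and x: "x \<notin> f ` set D"
  shows "model (f(y := x)) (y # D) S G"
proof -
  have eq: "(f(y := x)) a = f a" if "a \<in> set D" for a using that y by auto
  have "inj_on (f(y := x)) (set (y # D))"
    using m x y unfolding model_def by (auto simp: inj_on_def)
  moreover have "holds (f(y := x)) S"
    using m eq holds_cong[of S "f(y := x)" f] unfolding model_def by blast
  moreover have "good ((f(y := x)) a) ((f(y := x)) b)" if "(a, b) \<in> set G" for a b
    using m that eq unfolding model_def by fastforce
  ultimately show ?thesis using m unfolding model_def by fastforce
qed

text \<open>The exclusions in \<open>B\<close> concern one particular \<open>f\<close>, whereas
  \<open>Claw\<close> changes \<open>f\<close> at a new name. Hence \<open>B\<close> has to be empty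
  when \<open>p\<close> permits \<open>Claw\<close>.\<close>

lemma check_refutes:
  assumes "check p B D S G c" "model f D S G"
    and "p \<Longrightarrow> B = []" "\<And>T. T \<in> set B \<Longrightarrow> \<not> holds f T"
    and "\<And>v. p \<Longrightarrow> v \<in> V \<Longrightarrow> \<not> bisimplicial V E v"
    and "\<And>(f :: name \<Rightarrow> 'a) a b c d e g h i j k. p \<Longrightarrow> \<not> holds f (petersen a b c d e g h i j k)"
  shows False
  using assms
proof (induction p B D S G c arbitrary: f rule: check.induct)
  case (1 p B D S G a b c d)
  then show ?case using model_add[of f D S G a b "E (f a) (f b)"] 
      by (cases "E (f a) (f b)") auto
next
  case (2 p B D S G a b c d e f g)
  then show ?case using entails_holds no_path7 unfolding model_def by (metis check.simps(2))
next
  case (3 p B D S G a b c d)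
  then show ?case using entails_holds no_cycle4 unfolding model_def by (metis check.simps(3))
next
  case (4 p B D S G a b c d e)
  then show ?case using entails_holds no_gem unfolding model_def by (metis check.simps(4))
next
  case (5 p B D S G a b c d e f' g h i j)
  then show ?case using entails_holds "5.prems"(6) unfolding model_def by (metis check.simps(5))
next
  case (6 p B D S G n)
  then show ?case using entails_holds[of S "B ! n" f] unfolding model_def by auto
next
  case (7 p B D S G v s t K y c)
  note chk = "7.prems"(1)[unfolded check.simps]
  have v: "v \<in> set D" "s \<in> set D" "t \<in> set D" and g: "good (f v) (f s)" "good (f v) (f t)"
    using chk model_mem2[OF "7.prems"(2), of v s] model_mem2[OF "7.prems"(2), of v t] by simp_all
  have "f v \<in> V" using g edge_V unfolding good_def by blast
  then obtain x where x: "good (f v) x" "x \<noteq> f s" "x \<noteq> f t" "\<not> E x (f s)" "\<not> E x (f t)"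
    using ex_third_good[OF _ g] "7.prems"(5) chk by blast
  have vx: "E x (f v)" using x(1) sym unfolding good_def by blast
  \<comment> \<open>Serves both outcomes: \<open>h = f\<close> if \<open>x\<close> already has a
    name \<open>w\<close>, and \<open>h = f(y := x)\<close> with \<open>w = y\<close> if
    \<open>x\<close> is new.\<close>
  have ext: "model h D' (add w v True (add w s False (add w t False S))) ((v, w) # G)"
    if "model h D' S G" "h w = x" "h v = f v" "h s = f s" "h t = f t" "insert w (set D) \<subseteq> set D'" for h D' w
    using that v x vx irrefl by (intro model_good model_add) auto
  show ?case
  proof (cases "x \<in> f ` set D")
    case True
    then obtain w where w: "w \<in> set D" "x = f w" by blast
    have m: "holds f S" using "7.prems"(2) unfolding model_def by blast
    \<comment> \<open>All reasons by which \<open>check\<close> may dismiss \<open>w\<close>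
      contradict the choice of \<open>x\<close>, so \<open>K\<close> treats
      \<open>w\<close>.\<close>
    have "w \<noteq> v" "w \<noteq> s" "w \<noteq> t" using x w vx irrefl by auto
    moreover have "\<not> entails S [(w, [], [v])]" "\<not> entails S [(w, [s], [])]" "\<not> entails S [(w, [t], [])]"
      using entails_holds[of S "[(w, [], [v])]" f] entails_holds[of S "[(w, [s], [])]" f]
        entails_holds[of S "[(w, [t], [])]" f] m x w vx by (auto simp: holds_Cons)
    ultimately have "w \<in> set (map fst K)"
      using chk w unfolding list_all_iff by blast
    then obtain d where d: "(w, d) \<in> set K" by auto
    then have "check p B D (add w v True (add w s False (add w t False S))) ((v, w) # G) d"
      using chk unfolding list_all_iff by fast
    then show ?thesis using "7.IH"(1)[OF d refl] ext[of f D w] "7.prems" w by simp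
  next
    case False
    have y: "y \<notin> set D" using chk by blast
    have "v \<noteq> y" "s \<noteq> y" "t \<noteq> y" using v y by blast+
    moreover have "model (f(y := x)) (y # D) S G" using model_new[OF "7.prems"(2) y False] .
    ultimately have "model (f(y := x)) (y # D) (add y v True (add y s False (add y t False S))) ((v, y) # G)"
      by (intro ext) auto
    moreover have "B = []" using "7.prems"(3) chk by blast
    ultimately show ?thesis using "7.IH"(2) chk "7.prems" by simp
  qed
qed

subsection \<open>The graph around an induced Petersen graph\<close>

definition emb :: "(nat set \<Rightarrow> 'a) \<Rightarrow> bool" where
  "emb f \<longleftrightarrow> (\<forall>S\<in>petersen_V. \<forall>T\<in>petersen_V. S \<noteq> T \<longrightarrow> f S \<noteq> f T \<and> (E (f S) (f T) \<longleftrightarrow> S \<inter> T = {}))"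

lemma embD:
  "emb f \<Longrightarrow> S \<in> petersen_V \<Longrightarrow> T \<in> petersen_V \<Longrightarrow> S \<noteq> T \<Longrightarrow> f S \<noteq> f T \<and> (E (f S) (f T) \<longleftrightarrow> S \<inter> T = {})"
  unfolding emb_def by blast

text \<open>A permutation of the five points preserves disjointness, so it acts on the Petersen
  graph by automorphisms.\<close>

lemma emb_relabel:
  assumes f: "emb f" and s: "inj_on s {0..<5}" "s ` {0..<5} = {0..<5}"
  shows "emb (\<lambda>S. f (s ` S))"
proof -
  note img = petersen_V_image[OF s]
  have "s ` S \<noteq> s ` T" "s ` S \<inter> s ` T = {} \<longleftrightarrow> S \<inter> T = {}"
    if "S \<in> petersen_V" "T \<in> petersen_V" "S \<noteq> T" for S T
  proof -
    have *: "S \<subseteq> {0..<5}" "T \<subseteq> {0..<5}" using that unfolding petersen_V_def by blast+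
    show "s ` S \<noteq> s ` T" using inj_on_image_eq_iff[OF s(1) *] that(3) by blast
    show "s ` S \<inter> s ` T = {} \<longleftrightarrow> S \<inter> T = {}" using inj_on_image_Int[OF s(1) *] by auto
  qed
  then show ?thesis using embD[OF f] img unfolding emb_def by metis
qed

text \<open>\<open>f S\<close> together with its twins relative to the embedded Petersen graph.\<close>

definition blob :: "(nat set \<Rightarrow> 'a) \<Rightarrow> nat set \<Rightarrow> 'a set" where
  "blob f S = {x. \<forall>T\<in>petersen_V. (E x (f T) \<or> x = f T) \<longleftrightarrow> (S = T \<or> S \<inter> T = {})}"

definition hull :: "(nat set \<Rightarrow> 'a) \<Rightarrow> 'a set" where
  "hull f = (\<Union>S\<in>petersen_V. blob f S)"

lemma blobD:
  "x \<in> blob f S \<Longrightarrow> T \<in> petersen_V \<Longrightarrow> (E x (f T) \<or> x = f T) \<longleftrightarrow> (S = T \<or> S \<inter> T = {})"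
  unfolding blob_def by blast

lemma emb_in_blob: "emb f \<Longrightarrow> S \<in> petersen_V \<Longrightarrow> f S \<in> blob f S"
  using embD[of f S] irrefl unfolding blob_def by blast

lemma notin_hull: "emb f \<Longrightarrow> x \<notin> hull f \<Longrightarrow> S \<in> petersen_V \<Longrightarrow> x \<noteq> f S"
  using emb_in_blob unfolding hull_def by blast

text \<open>\<open>emb\<close> does not mention \<open>V\<close>; membership comes from an edge to a
  neighbour such as \<open>{c, d}\<close>.\<close>

lemma emb_V:
  assumes "emb f" "S \<in> petersen_V"
  shows "f S \<in> V"
proof -
  obtain a b c d e where p: "S = {a, b}" "perm5 [a, b, c, d, e]"
    using petersen_V_obtain[OF assms(2)] .
  note q = perm5D[OF p(2)]
  have "E (f S) (f {c, d})"
    using embD[OF assms, of "{c, d}"] q by (auto simp: p(1) petersen_V_pair)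
  then show ?thesis using edge_V by blast
qed

lemma blob_V: "emb f \<Longrightarrow> S \<in> petersen_V \<Longrightarrow> x \<in> blob f S \<Longrightarrow> x \<in> V"
  using blobD[of x f S S] emb_V[of f S] edge_V by auto

text \<open>Closed neighbourhoods in the Petersen graph are pairwise different: for an edge
  \<open>S T\<close> they are told apart by \<open>{a, e}\<close>, for a nonedge by \<open>T\<close>
  itself.\<close>

lemma blob_unique:
  assumes "x \<in> blob f S" "x \<in> blob f T" and S: "S \<in> petersen_V" and T: "T \<in> petersen_V"
  shows "S = T"
proof (rule ccontr)
  assume ne: "S \<noteq> T"
  have eq: "(S = U \<or> S \<inter> U = {}) \<longleftrightarrow> (T = U \<or> T \<inter> U = {})" if "U \<in> petersen_V" for U
    using blobD[OF assms(1) that] blobD[OF assms(2) that] by blast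
  show False
  proof (cases "S \<inter> T = {}")
    case True
    obtain a b c d e where p: "S = {a, b}" "T = {c, d}" "perm5 [a, b, c, d, e]"
      using petersen_V_disjoint[OF S T True] .
    note q = perm5D[OF p(3)]
    then have "{a, e} \<in> petersen_V" by (simp add: petersen_V_pair)
    from eq[OF this] q(2) show False unfolding p(1,2) by (auto simp: doubleton_eq_iff)
  next
    case False
    then show False using eq[OF T] eq[OF S] ne by blast
  qed
qed

text \<open>Relabelling only renames blobs: the one at \<open>S\<close> becomes the one at the image
  of \<open>S\<close> under \<open>s\<close>.\<close>

lemma hull_relabel:
  assumes s: "inj_on s {0..<5}" "s ` {0..<5} = {0..<5}" and x: "x \<notin> hull f"
  shows "x \<notin> hull (\<lambda>S. f (s ` S))"
proof
  assume "x \<in> hull (\<lambda>S. f (s ` S))"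
  then obtain S where S: "S \<in> petersen_V" "x \<in> blob (\<lambda>S. f (s ` S)) S" unfolding hull_def by blast
  note img = petersen_V_image[OF s]
  have "x \<in> blob f (s ` S)"
    unfolding blob_def
  proof (intro CollectI ballI)
    fix T assume T: "T \<in> petersen_V"
    define T' where "T' = {i \<in> {0..<5}. s i \<in> T}"
    have "T \<subseteq> s ` {0..<5}" using T unfolding s(2) petersen_V_def by blast
    then have TT: "T = s ` T'" unfolding T'_def by blast
    have sub: "T' \<subseteq> {0..<5}" unfolding T'_def by blast
    have "card T' = 2"
      using T card_image[OF inj_on_subset[OF s(1) sub]] unfolding petersen_V_def TT by simp
    then have T': "T' \<in> petersen_V" using sub unfolding petersen_V_def by blast
    have *: "S \<subseteq> {0..<5}" using S unfolding petersen_V_def by blast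
    show "(E x (f T) \<or> x = f T) \<longleftrightarrow> (s ` S = T \<or> s ` S \<inter> T = {})"
      unfolding TT using blobD[OF S(2) T'] inj_on_image_eq_iff[OF s(1) * sub]
        inj_on_image_Int[OF s(1) * sub] by auto
  qed
  then show False using x img[OF S(1)] unfolding hull_def by blast
qed

definition labelling :: "(nat set \<Rightarrow> 'a) \<Rightarrow> 'a \<Rightarrow> 'a \<Rightarrow> name \<Rightarrow> 'a" where
  "labelling f x y = case_name (f {0, 1}) (f {0, 2}) (f {0, 3}) (f {0, 4}) (f {1, 2}) (f {1, 3})
     (f {1, 4}) (f {2, 3}) (f {2, 4}) (f {3, 4}) x y"

lemma labelling_simps [simp]:
  "labelling f x y u0 = f {0, 1}" "labelling f x y u1 = f {0, 2}" "labelling f x y u2 = f {0, 3}"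
  "labelling f x y u3 = f {0, 4}" "labelling f x y u4 = f {1, 2}" "labelling f x y u5 = f {1, 3}"
  "labelling f x y u6 = f {1, 4}" "labelling f x y u7 = f {2, 3}" "labelling f x y u8 = f {2, 4}"
  "labelling f x y u9 = f {3, 4}" "labelling f x y u10 = x" "labelling f x y u11 = y"
  by (simp_all add: labelling_def)

lemma emb_pair:
  assumes "emb f" "a < 5" "b < 5" "a \<noteq> b" "c < 5" "d < 5" "c \<noteq> d" "{a, b} \<noteq> {c, d}"
  shows "f {a, b} \<noteq> f {c, d}" "E (f {a, b}) (f {c, d}) \<longleftrightarrow> {a, b} \<inter> {c, d} = {}"
  using embD[OF assms(1), of "{a, b}" "{c, d}"] assms by (auto simp: petersen_V_pair)

lemma model_petersen_rows:
  assumes f: "emb f" and x: "x \<notin> hull f" and y: "y \<notin> hull f"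
  shows "model (labelling f x y) [u0, u1, u2, u3, u4, u5, u6, u7, u8, u9, u10] petersen_rows []"
    and "x \<noteq> y \<Longrightarrow>
      model (labelling f x y) [u0, u1, u2, u3, u4, u5, u6, u7, u8, u9, u10, u11] petersen_rows []"
proof -
  have xy: "f {a, b} \<noteq> x" "f {a, b} \<noteq> y" if "a < 5" "b < 5" "a \<noteq> b" for a b
    using notin_hull[OF f x] notin_hull[OF f y] that petersen_V_pair by metis+
  have h: "holds (labelling f x y) petersen_rows"
    by (simp add: petersen_rows_def holds_Cons holds_Nil emb_pair[OF f] doubleton_eq_iff)
  have n: "names petersen_rows = {u0, u1, u2, u3, u4, u5, u6, u7, u8, u9}"
    by (auto simp: petersen_rows_def)
  have d: "distinct (map (labelling f x y) [u0, u1, u2, u3, u4, u5, u6, u7, u8, u9, u10])"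
    by (simp add: emb_pair[OF f] doubleton_eq_iff xy)
  then show "model (labelling f x y) [u0, u1, u2, u3, u4, u5, u6, u7, u8, u9, u10] petersen_rows []"
    unfolding model_def n using h by (simp add: distinct_map)
  assume "x \<noteq> y"
  then have "distinct (map (labelling f x y) [u0, u1, u2, u3, u4, u5, u6, u7, u8, u9, u10, u11])"
    by (simp add: emb_pair[OF f] doubleton_eq_iff xy)
  then show "model (labelling f x y) [u0, u1, u2, u3, u4, u5, u6, u7, u8, u9, u10, u11] petersen_rows []"
    unfolding model_def n using h by (simp add: distinct_map)
qed

section \<open>Attachment of outside vertices to the Petersen graph\<close>

text \<open>By symmetry the two neighbours are \<open>{0, 1}\<close> and \<open>{0, 2}\<close>. Then
  \<open>clique_cert\<close> leaves only a twin of \<open>{3, 4}\<close>, and twins lie in the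
  hull.\<close>

lemma attachment_clique:
  assumes f: "emb f" and x: "x \<notin> hull f" and S: "S \<in> petersen_V" and T: "T \<in> petersen_V" "S \<noteq> T"
    and adj: "E x (f S)" "E x (f T)"
  shows "S \<inter> T = {}"
proof (rule ccontr)
  assume ne: "S \<inter> T \<noteq> {}"
  obtain a b c d e where p: "S = {a, b}" "T = {a, c}" "perm5 [a, b, c, d, e]"
    using petersen_V_meet[OF S T ne] .
  define s where "s = (!) [a, b, c, d, e]"
  note s = perm5_nth_image[OF p(3), folded s_def]
  define g where "g = (\<lambda>S. f (s ` S))"
  have g: "emb g" "x \<notin> hull g"
    unfolding g_def using emb_relabel[OF f s] hull_relabel[OF s x] by auto
  have adj': "E x (g {0, 1})" "E x (g {0, 2})" using adj p by (simp_all add: g_def s_def)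
  \<comment> \<open>The second \<open>x\<close> is a dummy for \<open>u11\<close>, which is not in
    \<open>?D\<close>.\<close>
  let ?f = "labelling g x x"
  let ?D = "[u0, u1, u2, u3, u4, u5, u6, u7, u8, u9, u10]"
  have "model ?f ?D (add u10 u0 True (add u10 u1 True petersen_rows)) []"
    using model_petersen_rows(1)[OF g g(2)] adj' by (intro model_add) auto
  moreover have "\<not> holds ?f twin_config"
  proof
    assume *: "holds ?f twin_config"
    have "x \<in> blob g {3, 4}"
      unfolding blob_def petersen_V_eq using * by (auto simp: twin_config_def holds_def doubleton_eq_iff)
    then show False using g unfolding hull_def by (auto simp: petersen_V_pair)
  qed
  ultimately show False using check_refutes[OF clique_check] by auto
qed

text \<open>By symmetry \<open>S\<close> is \<open>{0, 1}\<close>, and \<open>transfer_cert\<close>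
  applies; its banned configurations are instances of \<open>attachment_clique\<close> for
  \<open>x\<close> or for \<open>y\<close>.\<close>

lemma attachment_transfer:
  assumes f: "emb f" and x: "x \<notin> hull f" and y: "y \<notin> hull f" and xy: "E x y"
    and S: "S \<in> petersen_V" and adj: "E x (f S)"
  shows "E y (f S)"
proof (rule ccontr)
  assume nadj: "\<not> E y (f S)"
  obtain a b c d e where p: "S = {a, b}" "perm5 [a, b, c, d, e]"
    using petersen_V_obtain[OF S] .
  define s where "s = (!) [a, b, c, d, e]"
  note s = perm5_nth_image[OF p(2), folded s_def]
  define g where "g = (\<lambda>S. f (s ` S))"
  have g: "emb g" "x \<notin> hull g" "y \<notin> hull g"
    unfolding g_def using emb_relabel[OF f s] hull_relabel[OF s x] hull_relabel[OF s y] by auto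
  have adj': "E x (g {0, 1})" "\<not> E y (g {0, 1})" using adj nadj p by (simp_all add: g_def s_def)
  let ?f = "labelling g x y"
  let ?D = "[u0, u1, u2, u3, u4, u5, u6, u7, u8, u9, u10, u11]"
  have "x \<noteq> y" using xy irrefl by blast
  then have "model ?f ?D (add u10 u0 True (add u11 u0 False (add u10 u11 True petersen_rows))) []"
    using model_petersen_rows(2)[OF g] adj' xy by (intro model_add) auto
  moreover have "\<not> holds ?f C" if "C \<in> set clique_configs" for C
  proof -
    have ne: "z \<noteq> g {i, j}" if "z = x \<or> z = y" "i < 5" "j < 5" "i \<noteq> j" for z i j
      using notin_hull[OF g(1) g(2)] notin_hull[OF g(1) g(3)] that petersen_V_pair by metis
    have cl: "E z (g {i, j}) \<longrightarrow> \<not> E z (g {k, l})"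
      if "z = x \<or> z = y" "i < 5" "j < 5" "k < 5" "l < 5" "i \<noteq> j" "k \<noteq> l"
        "{i, j} \<noteq> {k, l}" "{i, j} \<inter> {k, l} \<noteq> {}" for z i j k l
      using attachment_clique[OF g(1) g(2), of "{i, j}" "{k, l}"]
        attachment_clique[OF g(1) g(3), of "{i, j}" "{k, l}"] that by (auto simp: petersen_V_pair)
    show ?thesis
      using that unfolding clique_configs_def
      by (simp, elim disjE)
        (simp add: holds_Cons holds_Nil ne del: One_nat_def, rule cl, simp_all add: doubleton_eq_iff)+
  qed
  ultimately show False using check_refutes[OF transfer_check] by auto
qed

section \<open>Exchanging vertices of the Petersen graph for twins\<close>

text \<open>Any hull vertex can thus be made a vertex of the embedded Petersen graph, where the
  attachment lemmas apply to it.\<close>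

lemma blob_swap_emb:
  assumes f: "emb f" and S: "S \<in> petersen_V" and h: "h \<in> blob f S"
  shows "emb (f(S := h))"
proof -
  have key: "h \<noteq> f T \<and> (E h (f T) \<longleftrightarrow> S \<inter> T = {})" if T: "T \<in> petersen_V" "T \<noteq> S" for T
  proof -
    have "h \<noteq> f T" using blob_unique[OF h _ S T(1)] emb_in_blob[OF f T(1)] T(2) by blast
    then show ?thesis using blobD[OF h T(1)] T(2) by blast
  qed
  show ?thesis
    unfolding emb_def
  proof (intro ballI impI)
    fix A B assume AB: "A \<in> petersen_V" "B \<in> petersen_V" "A \<noteq> B"
    consider "A = S" "B \<noteq> S" | "A \<noteq> S" "B = S" | "A \<noteq> S" "B \<noteq> S" using AB(3) by blast
    then show "(f(S := h)) A \<noteq> (f(S := h)) B \<and> (E ((f(S := h)) A) ((f(S := h)) B) \<longleftrightarrow> A \<inter> B = {})"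
    proof cases
      case 1
      then show ?thesis using key[OF AB(2)] by simp
    next
      case 2
      then show ?thesis using key[OF AB(1)] edge_commute[of "f A" h] by (simp add: Int_commute) metis
    next
      case 3
      then show ?thesis using embD[OF f AB] by simp
    qed
  qed
qed

text \<open>\<open>S\<close> has two nonadjacent neighbours; nonadjacent twins would form a
  \<open>C4\<close> with them.\<close>

lemma blob_clique:
  assumes f: "emb f" and S: "S \<in> petersen_V" and x: "x \<in> blob f S" and y: "y \<in> blob f S" "x \<noteq> y"
  shows "E x y"
proof -
  obtain a b c d e where p: "S = {a, b}" "perm5 [a, b, c, d, e]"
    using petersen_V_obtain[OF S] .
  note q = perm5D[OF p(2)]
  have U: "{c, d} \<in> petersen_V" "{c, e} \<in> petersen_V" "{c, d} \<noteq> S" "{c, e} \<noteq> S" "{c, d} \<noteq> {c, e}"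
    "S \<inter> {c, d} = {}" "S \<inter> {c, e} = {}"
    using q by (auto simp: petersen_V_pair p(1) doubleton_eq_iff)
  have adj: "E z (f T)" if "z \<in> blob f S" "T \<in> petersen_V" "T \<noteq> S" "S \<inter> T = {}" for z T
  proof -
    have "z \<noteq> f T" using blob_unique[OF that(1) _ S that(2)] emb_in_blob[OF f that(2)] that(3) by blast
    then show ?thesis using blobD[OF that(1,2)] that(4) by blast
  qed
  have *: "E x (f {c, d})" "E x (f {c, e})" "E y (f {c, d})" "E y (f {c, e})"
    using adj x y(1) U by blast+
  have "f {c, d} \<noteq> f {c, e}" "\<not> E (f {c, d}) (f {c, e})"
    using embD[OF f U(1,2,5)] by auto
  then show ?thesis
    using C4_chord[of "f {c, d}" x "f {c, e}" y] * y(2) sym by blast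
qed

lemma blob_adjacent:
  assumes f: "emb f" and S: "S \<in> petersen_V" and T: "T \<in> petersen_V" "S \<noteq> T"
    and x: "x \<in> blob f S" and y: "y \<in> blob f T"
  shows "E x y \<longleftrightarrow> S \<inter> T = {}"
proof -
  define g where "g = f(S := x)"
  have g: "emb g" unfolding g_def using blob_swap_emb[OF f S x] .
  have gS: "g S = x" and gU: "\<And>U. U \<noteq> S \<Longrightarrow> g U = f U" by (simp_all add: g_def)
  have ynb: "E y (f U) \<longleftrightarrow> U \<inter> T = {}" if "U \<in> petersen_V" "U \<noteq> T" for U
  proof -
    have "y \<noteq> f U" using blob_unique[OF y _ T(1) that(1)] emb_in_blob[OF f that(1)] that(2) by blast
    then show ?thesis using blobD[OF y that(1)] that(2) by blast
  qed
  have yT: "E y (f T) \<or> y = f T" using blobD[OF y T(1)] by blast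
  have xnb: "E x (f U) \<longleftrightarrow> S \<inter> U = {}" if "U \<in> petersen_V" "U \<noteq> S" for U
    using embD[OF g S that(1)] gS gU[OF that(2)] that(2) by auto
  show ?thesis
  proof (cases "S \<inter> T = {}")
    case True
    obtain a b c d e where p: "S = {a, b}" "T = {c, d}" "perm5 [a, b, c, d, e]"
      using petersen_V_disjoint[OF S T(1) True] .
    note q = perm5D[OF p(3)]
    \<comment> \<open>\<open>W\<close> is adjacent to \<open>T\<close> but not to \<open>S\<close>.
      If \<open>x\<close> and \<open>y\<close> were nonadjacent, then \<open>f W\<close>,
      \<open>y\<close>, \<open>f S\<close>, \<open>x\<close> would be an induced path with hub
      \<open>f T\<close>, a gem.\<close>
    define W where "W = {a, e}"
    have W: "W \<in> petersen_V" "W \<noteq> S" "W \<noteq> T" "W \<inter> T = {}" "W \<inter> S \<noteq> {}"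
      using q by (auto simp: petersen_V_pair p(1,2) W_def doubleton_eq_iff)
    have "E x y"
    proof (rule ccontr)
      assume n: "\<not> E x y"
      have xT: "E x (f T)" using xnb[OF T(1)] T True by blast
      then have yT': "E y (f T)" using yT n by blast
      have xW: "\<not> E x (f W)" using xnb[OF W(1,2)] W by blast
      have yW: "E y (f W)" using ynb[OF W(1,3)] W by blast
      have TW: "E (f T) (f W)" using embD[OF f T(1) W(1)] W by blast
      have TS: "E (f T) (f S)" using embD[OF f T(1) S] T True by blast
      have yS: "E y (f S)" using ynb[OF S] T True by blast
      have SW: "\<not> E (f S) (f W)" using embD[OF f S W(1)] W by blast
      have xS: "E x (f S)" using blobD[OF x S] n yS sym by blast
      show False
        using gem_chord[of "f W" y "f S" x "f T"] yW yS xS xT yT' TW TS SW xW n sym by blast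
    qed
    then show ?thesis using True by blast
  next
    case False
    obtain a b c d e where p: "S = {a, b}" "T = {a, c}" "perm5 [a, b, c, d, e]"
      using petersen_V_meet[OF S T(1,2) False] .
    note q = perm5D[OF p(3)]
    \<comment> \<open>\<open>S\<close>, \<open>W\<close>, \<open>Z\<close>, \<open>T\<close> is an
      induced path of the Petersen graph; an edge \<open>x y\<close> between the twins of its ends
      would close it to a \<open>C4\<close>.\<close>
    define Z where "Z = {b, d}"
    define W where "W = {c, e}"
    have Z: "Z \<in> petersen_V" "Z \<noteq> S" "Z \<noteq> T" "Z \<inter> T = {}" "S \<inter> Z \<noteq> {}"
      and W: "W \<in> petersen_V" "W \<noteq> S" "W \<noteq> T" "W \<inter> T \<noteq> {}" "S \<inter> W = {}" "Z \<inter> W = {}" "Z \<noteq> W"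
      using q by (auto simp: petersen_V_pair p(1,2) Z_def W_def doubleton_eq_iff)
    have "\<not> E x y"
    proof
      assume xy: "E x y"
      have "E y (f Z)" "\<not> E y (f W)" using ynb Z W by blast+
      moreover have "E x (f W)" "\<not> E x (f Z)" using xnb Z W by blast+
      moreover have "E (f Z) (f W)" using embD[OF f Z(1) W(1)] W by blast
      moreover have "x \<noteq> f Z" using embD[OF g S Z(1)] gS gU[OF Z(2)] Z(2) by auto
      moreover have "y \<noteq> f W" using blob_unique[OF y _ T(1) W(1)] emb_in_blob[OF f W(1)] W(3) by blast
      ultimately show False using C4_chord[of x y "f Z" "f W"] xy sym by blast
    qed
    then show ?thesis using False by blast
  qed
qed

text \<open>Allows a second exchange after the first one.\<close>

lemma blob_swap:
  assumes f: "emb f" and S: "S \<in> petersen_V" and T: "T \<in> petersen_V" "S \<noteq> T"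
    and h: "h \<in> blob f S" and k: "k \<in> blob f T"
  shows "k \<in> blob (f(S := h)) T"
proof -
  have "k \<noteq> h" using blob_unique[of h f S T] h k S T by blast
  then have "(E k h \<or> k = h) \<longleftrightarrow> (T = S \<or> T \<inter> S = {})"
    using blob_adjacent[OF f S T h k] edge_commute[of k h] T(2) by blast
  then show ?thesis using k unfolding blob_def by auto
qed

text \<open>Only the vertex at \<open>S\<close> changes, so a new twin of \<open>T\<close> would see
  at least two of the three neighbours of \<open>T\<close> in the old copy. These are nonadjacent,
  against \<open>attachment_clique\<close>.\<close>

lemma hull_swap:
  assumes f: "emb f" and S: "S \<in> petersen_V" and h: "h \<in> blob f S" and x: "x \<notin> hull f"
  shows "x \<notin> hull (f(S := h))"
proof
  assume "x \<in> hull (f(S := h))"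
  then obtain T where T: "T \<in> petersen_V" "x \<in> blob (f(S := h)) T" unfolding hull_def by blast
  have adj: "E x (f U)" if "U \<in> petersen_V" "U \<noteq> S" "T \<inter> U = {}" for U
    using blobD[OF T(2) that(1)] that notin_hull[OF f x that(1)] by auto
  obtain a b c d e where p: "T = {a, b}" "perm5 [a, b, c, d, e]"
    using petersen_V_obtain[OF T(1)] .
  note q = perm5D[OF p(2)]
  have pV: "{c, d} \<in> petersen_V" "{c, e} \<in> petersen_V" "{d, e} \<in> petersen_V"
    "T \<inter> {c, d} = {}" "T \<inter> {c, e} = {}" "T \<inter> {d, e} = {}"
    "{c, d} \<noteq> {c, e}" "{c, d} \<noteq> {d, e}" "{c, e} \<noteq> {d, e}"
    "{c, d} \<inter> {c, e} \<noteq> {}" "{c, d} \<inter> {d, e} \<noteq> {}" "{c, e} \<inter> {d, e} \<noteq> {}"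
    using q by (auto simp: petersen_V_pair p(1) doubleton_eq_iff)
  then show False
    using adj attachment_clique[OF f x] by metis
qed

lemma hull_attachment:
  assumes f: "emb f" and x: "x \<notin> hull f" and y: "y \<notin> hull f" and xy: "E x y"
    and h: "h \<in> hull f" "E x h"
  shows "E y h"
proof -
  obtain S where S: "S \<in> petersen_V" "h \<in> blob f S" using h unfolding hull_def by blast
  have "E x ((f(S := h)) S)" using h by simp
  from attachment_transfer[OF blob_swap_emb[OF f S] hull_swap[OF f S x] hull_swap[OF f S y] xy S(1) this]
  show ?thesis by simp
qed

text \<open>Two neighbours from different blobs are exchanged into one Petersen graph, where
  \<open>attachment_clique\<close> makes their labels disjoint.\<close>

lemma hull_attachment_clique:
  assumes f: "emb f" and x: "x \<notin> hull f"
  shows "is_clique V E {h \<in> hull f. E x h}"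
  unfolding is_clique_def
proof (intro conjI ballI impI)
  show "{h \<in> hull f. E x h} \<subseteq> V" using edge_V by blast
  fix h k assume h: "h \<in> {h \<in> hull f. E x h}" and k: "k \<in> {h \<in> hull f. E x h}" and ne: "h \<noteq> k"
  obtain S T where S: "S \<in> petersen_V" "h \<in> blob f S" and T: "T \<in> petersen_V" "k \<in> blob f T"
    using h k unfolding hull_def by blast
  show "E h k"
  proof (cases "S = T")
    case True
    then show ?thesis using blob_clique[OF f S] T ne by blast
  next
    case False
    let ?g = "f(S := h)"
    let ?g' = "?g(T := k)"
    have g: "emb ?g" "x \<notin> hull ?g" "k \<in> blob ?g T"
      using blob_swap_emb[OF f S] hull_swap[OF f S x] blob_swap[OF f S(1) T(1) False S(2) T(2)] by auto
    have "S \<inter> T = {}"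
      using attachment_clique[OF blob_swap_emb[OF g(1) T(1) g(3)] hull_swap[OF g(1) T(1) g(3) g(2)] S(1) T(1) False]
        h k False by simp
    then show ?thesis using blob_adjacent[OF f S(1) T(1) False S(2) T(2)] by blast
  qed
qed

lemma hull_blowup:
  assumes f: "emb f" and V: "V \<subseteq> hull f"
  shows "clique_blowup V E petersen_V petersen_E"
  unfolding clique_blowup_def
proof (intro exI[of _ "blob f"] conjI ballI impI)
  fix S assume S: "S \<in> petersen_V"
  show "blob f S \<noteq> {}" using emb_in_blob[OF f S] by blast
  show "is_clique V E (blob f S)"
    using blob_clique[OF f S] blob_V[OF f S] unfolding is_clique_def by blast
  fix T assume T: "T \<in> petersen_V" "S \<noteq> T"
  show "blob f S \<inter> blob f T = {}" using blob_unique[OF _ _ S T(1)] T(2) by blast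
  show "E x y" if "petersen_E S T" "x \<in> blob f S" "y \<in> blob f T" for x y
    using blob_adjacent[OF f S T that(2,3)] that(1) unfolding petersen_E_def by blast
  show "\<not> E x y" if "\<not> petersen_E S T" "x \<in> blob f S" "y \<in> blob f T" for x y
    using blob_adjacent[OF f S T that(2,3)] that(1) S T(1) unfolding petersen_E_def by blast
next
  show "(\<Union>S\<in>petersen_V. blob f S) = V"
    using V blob_V[OF f] unfolding hull_def by blast
qed

lemma hull_clique_cutset:
  assumes f: "emb f" and conn: "connected_graph V E" and x: "x \<in> V" "x \<notin> hull f"
  shows "has_clique_cutset V E"
proof -
  define K where "K = {h \<in> hull f. E x h}"
  define W where "W = V - K"
  have K: "is_clique V E K" unfolding K_def using hull_attachment_clique[OF f x(2)] .
  have pV: "{0, 1} \<in> petersen_V" "{0, 2} \<in> petersen_V" "{0, 1} \<noteq> {0, 2 :: nat}" "{0, 1} \<inter> {0, 2 :: nat} \<noteq> {}"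
    by (auto simp: petersen_V_pair doubleton_eq_iff)
  \<comment> \<open>A clique cannot contain two nonadjacent vertices, so part of the hull survives
    the removal of \<open>K\<close>.\<close>
  have "\<not> (f {0, 1} \<in> K \<and> f {0, 2} \<in> K)"
    using embD[OF f pV(1-3)] pV(4) K unfolding is_clique_def by blast
  then obtain h where h: "h \<in> hull f" "h \<in> V" "h \<notin> K"
    using emb_in_blob[OF f] emb_V[OF f] pV unfolding hull_def by blast
  \<comment> \<open>Along a walk in \<open>W\<close> that starts at \<open>x\<close> the attachment
    remains \<open>K\<close>, so the walk could enter the hull only at a vertex of \<open>K\<close>,
    which \<open>W\<close> excludes.\<close>
  have reach: "y \<notin> hull f \<and> {h \<in> hull f. E y h} = K" if "(induced_rel W E)\<^sup>*\<^sup>* x y" for y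
    using that
  proof (induction rule: rtranclp_induct)
    case base
    then show ?case using x(2) K_def by blast
  next
    case (step y z)
    then have yz: "E y z" "z \<in> W" unfolding induced_rel_def by blast+
    then have z: "z \<notin> hull f" using step.IH unfolding W_def by blast
    have "E y h \<longleftrightarrow> E z h" if "h \<in> hull f" for h
      using hull_attachment[OF f _ z yz(1) that] hull_attachment[OF f z _ sym[OF yz(1)] that] step.IH by blast
    then show ?case using z step.IH by blast
  qed
  define C where "C = (\<lambda>x. {y \<in> W. (induced_rel W E)\<^sup>*\<^sup>* x y})"
  have xW: "x \<in> W" using x unfolding W_def K_def by blast
  have hW: "h \<in> W" using h unfolding W_def by blast
  have "\<not> (induced_rel W E)\<^sup>*\<^sup>* x h" using reach[of h, THEN conjunct1] h(1) by metis
  then have "h \<notin> C x" "h \<in> C h" using hW unfolding C_def by simp_all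
  then have "C h \<noteq> C x" by metis
  then have "card {C h, C x} = 2" by simp
  moreover have W: "components W E = C ` W" unfolding components_def C_def ..
  moreover have "{C h, C x} \<subseteq> C ` W" using xW hW by blast
  moreover have "finite W" unfolding W_def using fin by simp
  ultimately have "2 \<le> card (components W E)" by (metis card_mono finite_imageI)
  moreover have "components V E = {V}"
    using conn x(1) unfolding connected_graph_def components_def by auto
  ultimately have "clique_cutset V E K" using K unfolding clique_cutset_def W_def by simp
  then show ?thesis unfolding has_clique_cutset_def by blast
qed

lemma holds_petersen_emb:
  assumes "holds (f :: name \<Rightarrow> 'a) (petersen a b c d e g h i j k)"
  shows "\<exists>f. emb f"
proof -
  \<comment> \<open>The last alternative stands for \<open>{3, 4}\<close>; values outside
    \<open>petersen_V\<close> are irrelevant.\<close>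
  define w where "w S = (if S = {0, 1} then f a else if S = {0, 2} then f b else if S = {0, 3} then f c
    else if S = {0, 4} then f d else if S = {1, 2} then f e else if S = {1, 3} then f g
    else if S = {1, 4} then f h else if S = {2, 3} then f i else if S = {2, 4} then f j else f k)"
    for S :: "nat set"
  have w: "w {0, 1} = f a" "w {0, 2} = f b" "w {0, 3} = f c" "w {0, 4} = f d" "w {1, 2} = f e"
    "w {1, 3} = f g" "w {1, 4} = f h" "w {2, 3} = f i" "w {2, 4} = f j" "w {3, 4} = f k"
    by (simp_all add: w_def doubleton_eq_iff)
  have "emb w"
    unfolding emb_def petersen_V_eq using assms
    by (simp add: w petersen_def holds_Cons holds_Nil doubleton_eq_iff edge_commute del: One_nat_def)
      (simp add: eq_commute)
  then show ?thesis by blast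
qed

end

subsection \<open>Graphs without bisimplicial vertices contain a Petersen graph\<close>

text \<open>The first two \<open>Claw\<close> nodes give \<open>u0\<close> three pairwise
  nonadjacent good neighbours \<open>u1\<close>, \<open>u2\<close>, \<open>u3\<close>, and the
  others grow the graph from there. In every \<open>Pet\<close> leaf \<open>u0\<close> plays
  \<open>{0, 1}\<close> and these three are its neighbours.\<close>

definition claw_cert :: cert where
  "claw_cert =
    (Claw u0 u1 u1 [] u2 (Claw u0 u1 u2 [] u3 (Claw u1 u0 u0 [] u4 (Split u2 u4 (C4 u2 u4 u1 u0)
    (Split u3 u4 (C4 u3 u4 u1 u0) (Claw u2 u0 u0 [] u5 (Split u1 u5 (C4 u1 u5 u2 u0) (Split u3 u5
    (C4 u3 u5 u2 u0) (Split u4 u5 (Claw u1 u0 u4 [] u6 (Split u2 u6 (C4 u2 u6 u1 u0) (Split u3 u6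
    (C4 u3 u6 u1 u0) (Split u5 u6 (C4 u5 u6 u1 u4) (Claw u3 u0 u0 [] u7 (Split u1 u7 (C4 u1 u7 u3
    u0) (Split u2 u7 (C4 u2 u7 u3 u0) (Split u4 u7 (Split u6 u7 (C4 u6 u7 u4 u1) (Split u5 u7
    (Claw u2 u0 u5 [] u8 (Split u1 u8 (C4 u1 u8 u2 u0) (Split u3 u8 (C4 u3 u8 u2 u0) (Split u4 u8
    (C4 u4 u8 u2 u5) (Split u7 u8 (C4 u7 u8 u2 u5) (Split u6 u8 (P7 u1 u6 u8 u2 u5 u7 u3) (Claw u3
    u0 u7 [] u9 (Split u1 u9 (C4 u1 u9 u3 u0) (Split u2 u9 (C4 u2 u9 u3 u0) (Split u4 u9 (C4 u4 u9
    u3 u7) (Split u5 u9 (C4 u5 u9 u3 u7) (Split u6 u9 (P7 u1 u6 u9 u3 u7 u5 u2) (Split u8 u9 (P7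
    u1 u4 u5 u2 u8 u9 u3) (Claw u6 u1 u1 [] u10 (Split u0 u10 (C4 u0 u10 u6 u1) (Split u4 u10 (C4
    u4 u10 u6 u1) (Split u2 u10 (Split u3 u10 (C4 u3 u10 u2 u0) (Split u7 u10 (Split u5 u10 (Gem
    u4 u7 u10 u2 u5) (C4 u5 u2 u10 u7)) (P7 u2 u10 u6 u1 u4 u7 u3))) (Split u8 u10 (Split u5 u10
    (C4 u5 u10 u8 u2) (Split u3 u10 (P7 u1 u4 u5 u2 u8 u10 u3) (Split u9 u10 (P7 u1 u4 u5 u2 u8
    u10 u9) (P7 u6 u10 u8 u2 u0 u3 u9)))) (Split u5 u10 (Split u7 u10 (P7 u7 u10 u6 u1 u0 u2 u8)
    (Split u3 u10 (C4 u3 u10 u5 u7) (Split u9 u10 (P7 u6 u10 u9 u3 u0 u2 u8) (P7 u1 u6 u10 u5 u7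
    u3 u9)))) (P7 u8 u2 u5 u4 u1 u6 u10)))))))))))))))))))) (Claw u6 u1 u1 [] u8 (Split u0 u8 (C4
    u0 u8 u6 u1) (Split u4 u8 (C4 u4 u8 u6 u1) (Split u2 u8 (Split u3 u8 (C4 u3 u8 u2 u0) (Split
    u7 u8 (Split u5 u8 (C4 u5 u8 u7 u4) (Claw u3 u0 u7 [] u9 (Split u1 u9 (C4 u1 u9 u3 u0) (Split
    u2 u9 (C4 u2 u9 u3 u0) (Split u4 u9 (C4 u4 u9 u3 u7) (Split u8 u9 (C4 u8 u9 u3 u7) (Split u5
    u9 (Split u6 u9 (Pet u0 u4 u8 u9 u6 u5 u7 u3 u2 u1) (P7 u1 u6 u8 u2 u5 u9 u3)) (Split u6 u9
    (P7 u2 u5 u4 u1 u6 u9 u3) (Claw u6 u1 u8 [] u10 (Split u0 u10 (C4 u0 u10 u6 u1) (Split u2 u10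
    (C4 u2 u10 u6 u8) (Split u4 u10 (C4 u4 u10 u6 u1) (Split u7 u10 (C4 u7 u10 u6 u8) (Split u3
    u10 (Split u5 u10 (Pet u0 u4 u8 u10 u6 u5 u7 u3 u2 u1) (P7 u2 u5 u4 u1 u6 u10 u3)) (Split u5
    u10 (P7 u0 u3 u7 u4 u5 u10 u6) (Split u9 u10 (P7 u2 u5 u4 u1 u6 u10 u9) (P7 u9 u3 u0 u2 u8 u6
    u10))))))))))))))))) (P7 u2 u8 u6 u1 u4 u7 u3))) (Split u5 u8 (Split u7 u8 (C4 u7 u8 u5 u4)
    (Split u3 u8 (Claw u2 u0 u5 [] u9 (Split u1 u9 (C4 u1 u9 u2 u0) (Split u3 u9 (C4 u3 u9 u2 u0)
    (Split u4 u9 (C4 u4 u9 u2 u5) (Split u8 u9 (C4 u8 u9 u2 u5) (Split u6 u9 (Split u7 u9 (Pet u0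
    u4 u8 u9 u6 u7 u5 u2 u3 u1) (P7 u2 u9 u6 u1 u4 u7 u3)) (Split u7 u9 (P7 u1 u6 u8 u3 u7 u9 u2)
    (Claw u6 u1 u8 [] u10 (Split u0 u10 (C4 u0 u10 u6 u1) (Split u3 u10 (C4 u3 u10 u6 u8) (Split
    u4 u10 (C4 u4 u10 u6 u1) (Split u5 u10 (C4 u5 u10 u6 u8) (Split u2 u10 (Split u7 u10 (Pet u0
    u4 u8 u10 u6 u7 u5 u2 u3 u1) (P7 u2 u10 u6 u1 u4 u7 u3)) (Split u7 u10 (P7 u0 u2 u5 u4 u7 u10
    u6) (Split u9 u10 (P7 u2 u9 u10 u6 u1 u4 u7) (P7 u9 u2 u0 u3 u8 u6 u10)))))))))))))))) (P7 u0
    u3 u7 u4 u5 u8 u6))) (Split u3 u8 (P7 u2 u5 u4 u1 u6 u8 u3) (Split u7 u8 (P7 u0 u2 u5 u4 u7 u8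
    u6) (Claw u2 u0 u5 [] u9 (Split u1 u9 (C4 u1 u9 u2 u0) (Split u3 u9 (C4 u3 u9 u2 u0) (Split u4
    u9 (C4 u4 u9 u2 u5) (Split u6 u9 (Split u7 u9 (Claw u3 u0 u7 [] u10 (Split u1 u10 (C4 u1 u10
    u3 u0) (Split u2 u10 (C4 u2 u10 u3 u0) (Split u4 u10 (C4 u4 u10 u3 u7) (Split u9 u10 (C4 u9
    u10 u3 u7) (Split u5 u10 (Split u6 u10 (Pet u0 u4 u9 u10 u6 u5 u7 u3 u2 u1) (P7 u1 u6 u9 u2 u5
    u10 u3)) (Split u6 u10 (P7 u2 u5 u4 u1 u6 u10 u3) (Split u8 u10 (P7 u2 u5 u4 u1 u6 u8 u10) (P7
    u8 u6 u1 u4 u7 u3 u10))))))))) (P7 u2 u9 u6 u1 u4 u7 u3)) (Split u8 u9 (Split u7 u9 (Claw u3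
    u0 u7 [] u10 (Split u1 u10 (C4 u1 u10 u3 u0) (Split u2 u10 (C4 u2 u10 u3 u0) (Split u4 u10 (C4
    u4 u10 u3 u7) (Split u9 u10 (C4 u9 u10 u3 u7) (Split u6 u10 (P7 u1 u6 u10 u3 u7 u9 u2) (Split
    u8 u10 (P7 u0 u1 u4 u7 u9 u8 u10) (P7 u1 u6 u8 u9 u7 u3 u10)))))))) (P7 u2 u9 u8 u6 u1 u4 u7))
    (P7 u8 u6 u1 u4 u5 u2 u9)))))))))))))))) (Split u5 u7 (Split u6 u7 (Claw u2 u0 u5 [] u8 (Split
    u1 u8 (C4 u1 u8 u2 u0) (Split u3 u8 (C4 u3 u8 u2 u0) (Split u4 u8 (C4 u4 u8 u2 u5) (Split u7
    u8 (C4 u7 u8 u2 u5) (Split u6 u8 (Claw u3 u0 u7 [] u9 (Split u1 u9 (C4 u1 u9 u3 u0) (Split u2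
    u9 (C4 u2 u9 u3 u0) (Split u5 u9 (C4 u5 u9 u3 u7) (Split u6 u9 (C4 u6 u9 u3 u7) (Split u4 u9
    (Split u8 u9 (Pet u0 u4 u7 u8 u6 u9 u5 u2 u3 u1) (P7 u2 u8 u6 u1 u4 u9 u3)) (Split u8 u9 (P7
    u1 u4 u5 u2 u8 u9 u3) (Claw u9 u3 u3 [] u10 (Split u0 u10 (C4 u0 u10 u9 u3) (Split u7 u10 (C4
    u7 u10 u9 u3) (Split u1 u10 (Split u2 u10 (C4 u2 u10 u1 u0) (Split u5 u10 (Split u4 u10 (Split
    u8 u10 (C4 u8 u10 u5 u2) (P7 u4 u10 u9 u3 u0 u2 u8)) (C4 u4 u1 u10 u5)) (P7 u1 u10 u9 u3 u7 u5
    u2))) (Split u6 u10 (Split u4 u10 (C4 u4 u10 u6 u1) (Split u5 u10 (C4 u5 u10 u6 u7) (P7 u1 u4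
    u5 u7 u3 u9 u10))) (Split u2 u10 (P7 u1 u6 u7 u3 u9 u10 u2) (Split u4 u10 (Split u8 u10 (P7 u0
    u3 u7 u6 u8 u10 u4) (P7 u2 u8 u6 u1 u4 u10 u9)) (P7 u4 u1 u6 u7 u3 u9 u10))))))))))))))) (Claw
    u8 u2 u2 [] u9 (Split u0 u9 (C4 u0 u9 u8 u2) (Split u5 u9 (C4 u5 u9 u8 u2) (Split u1 u9 (Split
    u3 u9 (C4 u3 u9 u1 u0) (Split u7 u9 (Split u6 u9 (Claw u8 u2 u9 [] u10 (Split u1 u10 (C4 u1
    u10 u8 u9) (Split u5 u10 (C4 u5 u10 u8 u2) (Split u6 u10 (C4 u6 u10 u8 u9) (Split u7 u10 (C4
    u7 u10 u8 u9) (P7 u1 u6 u7 u5 u2 u8 u10)))))) (C4 u6 u1 u9 u7)) (P7 u1 u9 u8 u2 u5 u7 u3)))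
    (Split u4 u9 (Split u6 u9 (C4 u6 u9 u4 u1) (Split u7 u9 (C4 u7 u9 u4 u5) (P7 u1 u6 u7 u5 u2 u8
    u9))) (Split u3 u9 (P7 u1 u4 u5 u2 u8 u9 u3) (Split u6 u9 (Split u7 u9 (P7 u0 u1 u4 u5 u7 u9
    u8) (Claw u3 u0 u7 [] u10 (Split u1 u10 (C4 u1 u10 u3 u0) (Split u2 u10 (C4 u2 u10 u3 u0)
    (Split u5 u10 (C4 u5 u10 u3 u7) (Split u6 u10 (C4 u6 u10 u3 u7) (Split u8 u10 (P7 u1 u6 u7 u3
    u10 u8 u2) (Split u9 u10 (P7 u0 u2 u5 u7 u6 u9 u10) (P7 u2 u8 u9 u6 u7 u3 u10))))))))) (P7 u6
    u1 u4 u5 u2 u8 u9)))))))))))))) (Claw u3 u0 u7 [] u8 (Split u1 u8 (C4 u1 u8 u3 u0) (Split u2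
    u8 (C4 u2 u8 u3 u0) (Split u5 u8 (C4 u5 u8 u3 u7) (Split u6 u8 (P7 u1 u6 u8 u3 u7 u5 u2)
    (Split u4 u8 (Claw u6 u1 u1 [] u9 (Split u0 u9 (C4 u0 u9 u6 u1) (Split u4 u9 (C4 u4 u9 u6 u1)
    (Split u2 u9 (Split u3 u9 (C4 u3 u9 u2 u0) (Split u8 u9 (Split u5 u9 (C4 u5 u9 u8 u4) (Split
    u7 u9 (C4 u7 u9 u2 u5) (P7 u1 u6 u9 u2 u5 u7 u3))) (P7 u2 u9 u6 u1 u4 u8 u3))) (Split u5 u9
    (Split u8 u9 (C4 u8 u9 u5 u4) (Split u3 u9 (Split u7 u9 (Claw u6 u1 u9 [] u10 (Split u3 u10
    (C4 u3 u10 u6 u9) (Split u4 u10 (C4 u4 u10 u6 u1) (Split u5 u10 (C4 u5 u10 u6 u9) (Split u7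
    u10 (C4 u7 u10 u6 u9) (P7 u3 u7 u5 u4 u1 u6 u10)))))) (C4 u7 u3 u9 u5)) (P7 u0 u3 u8 u4 u5 u9
    u6))) (Split u3 u9 (P7 u2 u5 u4 u1 u6 u9 u3) (Split u7 u9 (Claw u2 u0 u5 [] u10 (Split u1 u10
    (C4 u1 u10 u2 u0) (Split u3 u10 (C4 u3 u10 u2 u0) (Split u4 u10 (C4 u4 u10 u2 u5) (Split u7
    u10 (C4 u7 u10 u2 u5) (Split u6 u10 (P7 u1 u6 u10 u2 u5 u7 u3) (Split u9 u10 (P7 u0 u1 u4 u5
    u7 u9 u10) (P7 u1 u6 u9 u7 u5 u2 u10)))))))) (P7 u3 u7 u5 u4 u1 u6 u9)))))))) (P7 u6 u1 u4 u5
    u7 u3 u8)))))))) (Split u6 u7 (P7 u2 u5 u4 u1 u6 u7 u3) (Claw u7 u3 u3 [] u8 (Split u0 u8 (C4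
    u0 u8 u7 u3) (Split u1 u8 (Split u2 u8 (C4 u2 u8 u1 u0) (Split u5 u8 (Split u4 u8 (Claw u7 u3
    u8 [] u9 (Split u0 u9 (C4 u0 u9 u7 u3) (Split u1 u9 (C4 u1 u9 u7 u8) (Split u4 u9 (C4 u4 u9 u7
    u8) (Split u5 u9 (C4 u5 u9 u7 u8) (P7 u5 u4 u1 u0 u3 u7 u9)))))) (C4 u4 u1 u8 u5)) (Split u4
    u8 (Claw u2 u0 u5 [] u9 (Split u1 u9 (C4 u1 u9 u2 u0) (Split u3 u9 (C4 u3 u9 u2 u0) (Split u4
    u9 (C4 u4 u9 u2 u5) (Split u7 u9 (P7 u1 u4 u5 u2 u9 u7 u3) (Split u8 u9 (Claw u3 u0 u7 [] u10
    (Split u1 u10 (C4 u1 u10 u3 u0) (Split u2 u10 (C4 u2 u10 u3 u0) (Split u8 u10 (C4 u8 u10 u3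
    u7) (Split u5 u10 (P7 u1 u8 u7 u3 u10 u5 u2) (Split u4 u10 (Split u9 u10 (C4 u9 u10 u4 u8) (P7
    u5 u2 u9 u8 u7 u3 u10)) (P7 u2 u5 u4 u8 u7 u3 u10))))))) (P7 u3 u7 u8 u4 u5 u2 u9))))))) (P7
    u2 u5 u4 u1 u8 u7 u3)))) (Split u4 u8 (Split u6 u8 (C4 u6 u8 u4 u1) (Split u5 u8 (P7 u5 u8 u7
    u3 u0 u1 u6) (Split u2 u8 (C4 u2 u8 u4 u5) (Claw u2 u0 u5 [] u9 (Split u1 u9 (C4 u1 u9 u2 u0)
    (Split u3 u9 (C4 u3 u9 u2 u0) (Split u4 u9 (C4 u4 u9 u2 u5) (Split u7 u9 (P7 u1 u4 u5 u2 u9 u7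
    u3) (Split u8 u9 (Split u6 u9 (Claw u3 u0 u7 [] u10 (Split u1 u10 (C4 u1 u10 u3 u0) (Split u2
    u10 (C4 u2 u10 u3 u0) (Split u8 u10 (C4 u8 u10 u3 u7) (Split u4 u10 (Split u6 u10 (C4 u6 u10
    u4 u1) (Split u9 u10 (C4 u9 u10 u4 u8) (P7 u0 u3 u10 u4 u8 u9 u6))) (Split u5 u10 (Split u9
    u10 (C4 u9 u10 u5 u2) (P7 u0 u3 u10 u5 u4 u8 u9)) (P7 u2 u5 u4 u8 u7 u3 u10))))))) (P7 u6 u1
    u0 u2 u9 u8 u7)) (P7 u3 u7 u8 u4 u5 u2 u9)))))))))) (Split u5 u8 (Split u6 u8 (Split u2 u8
    (Claw u3 u0 u7 [] u9 (Split u1 u9 (C4 u1 u9 u3 u0) (Split u2 u9 (C4 u2 u9 u3 u0) (Split u8 u9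
    (C4 u8 u9 u3 u7) (Split u4 u9 (P7 u1 u4 u9 u3 u7 u8 u2) (Split u5 u9 (Split u6 u9 (C4 u6 u9 u5
    u8) (P7 u4 u1 u6 u8 u7 u3 u9)) (P7 u1 u4 u5 u8 u7 u3 u9))))))) (Claw u2 u0 u5 [] u9 (Split u1
    u9 (C4 u1 u9 u2 u0) (Split u3 u9 (C4 u3 u9 u2 u0) (Split u4 u9 (C4 u4 u9 u2 u5) (Split u8 u9
    (C4 u8 u9 u2 u5) (Split u7 u9 (P7 u0 u1 u4 u5 u8 u7 u9) (Split u6 u9 (Claw u3 u0 u7 [] u10
    (Split u1 u10 (C4 u1 u10 u3 u0) (Split u2 u10 (C4 u2 u10 u3 u0) (Split u8 u10 (C4 u8 u10 u3
    u7) (Split u5 u10 (Split u6 u10 (C4 u6 u10 u5 u8) (Split u9 u10 (C4 u9 u10 u5 u2) (P7 u0 u3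
    u10 u5 u8 u6 u9))) (Split u4 u10 (Split u6 u10 (C4 u6 u10 u4 u1) (P7 u0 u3 u10 u4 u5 u8 u6))
    (P7 u1 u4 u5 u8 u7 u3 u10))))))) (P7 u6 u8 u7 u3 u0 u2 u9))))))))) (P7 u3 u7 u8 u5 u4 u1 u6))
    (P7 u5 u4 u1 u0 u3 u7 u8)))))))))))))))) (Claw u3 u0 u0 [] u6 (Split u1 u6 (C4 u1 u6 u3 u0)
    (Split u2 u6 (C4 u2 u6 u3 u0) (Split u4 u6 (Split u5 u6 (Claw u3 u0 u6 [] u7 (Split u1 u7 (C4
    u1 u7 u3 u0) (Split u2 u7 (C4 u2 u7 u3 u0) (Split u4 u7 (C4 u4 u7 u3 u6) (Split u5 u7 (C4 u5
    u7 u3 u6) (Claw u7 u3 u3 [] u8 (Split u0 u8 (C4 u0 u8 u7 u3) (Split u6 u8 (C4 u6 u8 u7 u3)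
    (Split u1 u8 (Split u2 u8 (C4 u2 u8 u1 u0) (Split u5 u8 (Split u4 u8 (C4 u4 u8 u5 u6) (Claw u2
    u0 u5 [] u9 (Split u1 u9 (C4 u1 u9 u2 u0) (Split u3 u9 (C4 u3 u9 u2 u0) (Split u6 u9 (C4 u6 u9
    u2 u5) (Split u8 u9 (C4 u8 u9 u2 u5) (Split u4 u9 (Split u7 u9 (Pet u0 u4 u5 u7 u8 u9 u6 u3 u2
    u1) (P7 u2 u9 u4 u1 u8 u7 u3)) (Split u7 u9 (P7 u1 u4 u6 u3 u7 u9 u2) (Claw u7 u3 u8 [] u10
    (Split u0 u10 (C4 u0 u10 u7 u3) (Split u1 u10 (C4 u1 u10 u7 u8) (Split u5 u10 (C4 u5 u10 u7
    u8) (Split u6 u10 (C4 u6 u10 u7 u3) (Split u2 u10 (Split u4 u10 (Pet u0 u4 u5 u7 u8 u10 u6 u3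
    u2 u1) (P7 u1 u4 u6 u3 u7 u10 u2)) (Split u4 u10 (P7 u0 u2 u5 u6 u4 u10 u7) (Split u9 u10 (P7
    u1 u4 u6 u3 u7 u10 u9) (P7 u9 u2 u0 u1 u8 u7 u10))))))))))))))))) (P7 u1 u8 u7 u3 u6 u5 u2)))
    (Split u4 u8 (Split u5 u8 (C4 u5 u8 u4 u6) (Split u2 u8 (Claw u1 u0 u4 [] u9 (Split u2 u9 (C4
    u2 u9 u1 u0) (Split u3 u9 (C4 u3 u9 u1 u0) (Split u6 u9 (C4 u6 u9 u1 u4) (Split u8 u9 (C4 u8
    u9 u1 u4) (Split u5 u9 (Split u7 u9 (Pet u0 u4 u5 u7 u9 u8 u6 u3 u2 u1) (P7 u1 u9 u5 u2 u8 u7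
    u3)) (Split u7 u9 (P7 u1 u9 u7 u3 u6 u5 u2) (Claw u7 u3 u8 [] u10 (Split u0 u10 (C4 u0 u10 u7
    u3) (Split u2 u10 (C4 u2 u10 u7 u8) (Split u4 u10 (C4 u4 u10 u7 u8) (Split u6 u10 (C4 u6 u10
    u7 u3) (Split u1 u10 (Split u5 u10 (Pet u0 u4 u5 u7 u10 u8 u6 u3 u2 u1) (P7 u1 u10 u7 u3 u6 u5
    u2)) (Split u5 u10 (P7 u0 u1 u4 u6 u5 u10 u7) (Split u9 u10 (P7 u1 u9 u10 u7 u3 u6 u5) (P7 u9
    u1 u0 u2 u8 u7 u10)))))))))))))))) (P7 u0 u2 u5 u6 u4 u8 u7))) (Split u2 u8 (P7 u1 u4 u6 u3 u7
    u8 u2) (Split u5 u8 (P7 u0 u1 u4 u6 u5 u8 u7) (Claw u1 u0 u4 [] u9 (Split u2 u9 (C4 u2 u9 u1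
    u0) (Split u3 u9 (C4 u3 u9 u1 u0) (Split u6 u9 (C4 u6 u9 u1 u4) (Split u7 u9 (Split u5 u9
    (Claw u2 u0 u5 [] u10 (Split u1 u10 (C4 u1 u10 u2 u0) (Split u3 u10 (C4 u3 u10 u2 u0) (Split
    u6 u10 (C4 u6 u10 u2 u5) (Split u9 u10 (C4 u9 u10 u2 u5) (Split u4 u10 (Split u7 u10 (Pet u0
    u4 u5 u7 u9 u10 u6 u3 u2 u1) (P7 u2 u10 u4 u1 u9 u7 u3)) (Split u7 u10 (P7 u1 u4 u6 u3 u7 u10
    u2) (Split u8 u10 (P7 u1 u4 u6 u3 u7 u8 u10) (P7 u8 u7 u3 u6 u5 u2 u10))))))))) (P7 u1 u9 u7
    u3 u6 u5 u2)) (Split u8 u9 (Split u5 u9 (Claw u2 u0 u5 [] u10 (Split u1 u10 (C4 u1 u10 u2 u0)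
    (Split u3 u10 (C4 u3 u10 u2 u0) (Split u6 u10 (C4 u6 u10 u2 u5) (Split u9 u10 (C4 u9 u10 u2
    u5) (Split u7 u10 (P7 u1 u9 u5 u2 u10 u7 u3) (Split u8 u10 (P7 u0 u3 u6 u5 u9 u8 u10) (P7 u3
    u7 u8 u9 u5 u2 u10)))))))) (P7 u1 u9 u8 u7 u3 u6 u5)) (P7 u8 u7 u3 u6 u4 u1
    u9))))))))))))))))))) (Claw u1 u0 u4 [] u7 (Split u2 u7 (C4 u2 u7 u1 u0) (Split u3 u7 (C4 u3
    u7 u1 u0) (Split u6 u7 (C4 u6 u7 u1 u4) (Split u5 u7 (P7 u2 u5 u7 u1 u4 u6 u3) (Claw u5 u2 u2
    [] u8 (Split u0 u8 (C4 u0 u8 u5 u2) (Split u1 u8 (Split u3 u8 (C4 u3 u8 u1 u0) (Split u6 u8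
    (Split u4 u8 (Claw u5 u2 u8 [] u9 (Split u0 u9 (C4 u0 u9 u5 u2) (Split u1 u9 (C4 u1 u9 u5 u8)
    (Split u4 u9 (C4 u4 u9 u5 u8) (Split u6 u9 (C4 u6 u9 u5 u8) (P7 u6 u4 u1 u0 u2 u5 u9)))))) (C4
    u4 u1 u8 u6)) (Split u4 u8 (Claw u2 u0 u5 [] u9 (Split u1 u9 (C4 u1 u9 u2 u0) (Split u3 u9 (C4
    u3 u9 u2 u0) (Split u8 u9 (C4 u8 u9 u2 u5) (Split u6 u9 (P7 u1 u8 u5 u2 u9 u6 u3) (Split u4 u9
    (Claw u3 u0 u6 [] u10 (Split u1 u10 (C4 u1 u10 u3 u0) (Split u2 u10 (C4 u2 u10 u3 u0) (Split
    u4 u10 (C4 u4 u10 u3 u6) (Split u5 u10 (P7 u1 u4 u6 u3 u10 u5 u2) (Split u8 u10 (Split u9 u10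
    (C4 u9 u10 u8 u4) (P7 u5 u2 u9 u4 u6 u3 u10)) (P7 u2 u5 u8 u4 u6 u3 u10))))))) (P7 u3 u6 u4 u8
    u5 u2 u9))))))) (P7 u2 u5 u8 u1 u4 u6 u3)))) (Split u4 u8 (Split u7 u8 (C4 u7 u8 u4 u1) (Split
    u6 u8 (P7 u6 u8 u5 u2 u0 u1 u7) (Split u3 u8 (C4 u3 u8 u4 u6) (Claw u3 u0 u6 [] u9 (Split u1
    u9 (C4 u1 u9 u3 u0) (Split u2 u9 (C4 u2 u9 u3 u0) (Split u4 u9 (C4 u4 u9 u3 u6) (Split u5 u9
    (P7 u1 u4 u6 u3 u9 u5 u2) (Split u8 u9 (Split u7 u9 (Claw u2 u0 u5 [] u10 (Split u1 u10 (C4 u1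
    u10 u2 u0) (Split u3 u10 (C4 u3 u10 u2 u0) (Split u8 u10 (C4 u8 u10 u2 u5) (Split u4 u10
    (Split u7 u10 (C4 u7 u10 u4 u1) (Split u9 u10 (C4 u9 u10 u4 u8) (P7 u0 u2 u10 u4 u8 u9 u7)))
    (Split u6 u10 (Split u9 u10 (C4 u9 u10 u6 u3) (P7 u0 u2 u10 u6 u4 u8 u9)) (P7 u3 u6 u4 u8 u5
    u2 u10))))))) (P7 u5 u8 u9 u3 u0 u1 u7)) (P7 u2 u5 u8 u4 u6 u3 u9)))))))))) (Split u6 u8
    (Split u7 u8 (Split u3 u8 (Claw u2 u0 u5 [] u9 (Split u1 u9 (C4 u1 u9 u2 u0) (Split u3 u9 (C4
    u3 u9 u2 u0) (Split u8 u9 (C4 u8 u9 u2 u5) (Split u4 u9 (P7 u1 u4 u9 u2 u5 u8 u3) (Split u6 u9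
    (Split u7 u9 (C4 u7 u9 u6 u8) (P7 u4 u1 u7 u8 u5 u2 u9)) (P7 u1 u4 u6 u8 u5 u2 u9))))))) (Claw
    u2 u0 u5 [] u9 (Split u1 u9 (C4 u1 u9 u2 u0) (Split u8 u9 (C4 u8 u9 u2 u5) (Split u7 u9 (Split
    u4 u9 (C4 u4 u9 u7 u1) (Split u6 u9 (C4 u6 u9 u7 u8) (P7 u0 u2 u9 u7 u8 u6 u4))) (Split u4 u9
    (Split u6 u9 (Claw u5 u2 u8 [] u10 (Split u0 u10 (C4 u0 u10 u5 u2) (Split u6 u10 (C4 u6 u10 u5
    u8) (Split u9 u10 (C4 u9 u10 u5 u2) (Split u1 u10 (P7 u0 u1 u10 u5 u8 u6 u9) (Split u3 u10
    (Split u4 u10 (C4 u4 u10 u3 u6) (P7 u0 u1 u4 u6 u8 u5 u10)) (P7 u1 u0 u3 u6 u8 u5 u10)))))))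
    (P7 u0 u2 u9 u4 u6 u8 u7)) (P7 u4 u1 u7 u8 u5 u2 u9))))))) (P7 u2 u5 u8 u6 u4 u1 u7)) (P7 u6
    u4 u1 u0 u2 u5 u8)))))))))))) (Split u5 u6 (Claw u2 u0 u5 [] u7 (Split u1 u7 (C4 u1 u7 u2 u0)
    (Split u3 u7 (C4 u3 u7 u2 u0) (Split u6 u7 (C4 u6 u7 u2 u5) (Split u4 u7 (P7 u1 u4 u7 u2 u5 u6
    u3) (Claw u4 u1 u1 [] u8 (Split u0 u8 (C4 u0 u8 u4 u1) (Split u2 u8 (Split u3 u8 (C4 u3 u8 u2
    u0) (Split u6 u8 (Split u5 u8 (Claw u4 u1 u8 [] u9 (Split u0 u9 (C4 u0 u9 u4 u1) (Split u2 u9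
    (C4 u2 u9 u4 u8) (Split u5 u9 (C4 u5 u9 u4 u8) (Split u6 u9 (C4 u6 u9 u4 u8) (P7 u6 u5 u2 u0
    u1 u4 u9)))))) (C4 u5 u2 u8 u6)) (Split u5 u8 (Claw u1 u0 u4 [] u9 (Split u2 u9 (C4 u2 u9 u1
    u0) (Split u3 u9 (C4 u3 u9 u1 u0) (Split u8 u9 (C4 u8 u9 u1 u4) (Split u6 u9 (P7 u2 u8 u4 u1
    u9 u6 u3) (Split u5 u9 (Claw u3 u0 u6 [] u10 (Split u1 u10 (C4 u1 u10 u3 u0) (Split u2 u10 (C4
    u2 u10 u3 u0) (Split u5 u10 (C4 u5 u10 u3 u6) (Split u4 u10 (P7 u1 u4 u10 u3 u6 u5 u2) (Split
    u8 u10 (Split u9 u10 (C4 u9 u10 u8 u5) (P7 u4 u1 u9 u5 u6 u3 u10)) (P7 u1 u4 u8 u5 u6 u3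
    u10))))))) (P7 u3 u6 u5 u8 u4 u1 u9))))))) (P7 u1 u4 u8 u2 u5 u6 u3)))) (Split u5 u8 (Split u7
    u8 (C4 u7 u8 u5 u2) (Split u6 u8 (P7 u6 u8 u4 u1 u0 u2 u7) (Split u3 u8 (C4 u3 u8 u5 u6) (Claw
    u3 u0 u6 [] u9 (Split u1 u9 (C4 u1 u9 u3 u0) (Split u2 u9 (C4 u2 u9 u3 u0) (Split u5 u9 (C4 u5
    u9 u3 u6) (Split u4 u9 (P7 u1 u4 u9 u3 u6 u5 u2) (Split u8 u9 (Split u7 u9 (Claw u1 u0 u4 []
    u10 (Split u2 u10 (C4 u2 u10 u1 u0) (Split u3 u10 (C4 u3 u10 u1 u0) (Split u8 u10 (C4 u8 u10
    u1 u4) (Split u5 u10 (Split u7 u10 (C4 u7 u10 u5 u2) (Split u9 u10 (C4 u9 u10 u5 u8) (P7 u0 u1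
    u10 u5 u8 u9 u7))) (Split u6 u10 (Split u9 u10 (C4 u9 u10 u6 u3) (P7 u0 u1 u10 u6 u5 u8 u9))
    (P7 u3 u6 u5 u8 u4 u1 u10))))))) (P7 u4 u8 u9 u3 u0 u2 u7)) (P7 u1 u4 u8 u5 u6 u3 u9))))))))))
    (Split u6 u8 (Split u7 u8 (Split u3 u8 (Claw u1 u0 u4 [] u9 (Split u2 u9 (C4 u2 u9 u1 u0)
    (Split u3 u9 (C4 u3 u9 u1 u0) (Split u8 u9 (C4 u8 u9 u1 u4) (Split u5 u9 (P7 u2 u5 u9 u1 u4 u8
    u3) (Split u6 u9 (Split u7 u9 (C4 u7 u9 u6 u8) (P7 u4 u1 u9 u6 u5 u2 u7)) (P7 u2 u5 u6 u8 u4
    u1 u9))))))) (Claw u1 u0 u4 [] u9 (Split u2 u9 (C4 u2 u9 u1 u0) (Split u8 u9 (C4 u8 u9 u1 u4)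
    (Split u7 u9 (Split u5 u9 (C4 u5 u9 u7 u2) (Split u6 u9 (C4 u6 u9 u7 u8) (P7 u0 u1 u9 u7 u8 u6
    u5))) (Split u5 u9 (Split u6 u9 (Claw u4 u1 u8 [] u10 (Split u0 u10 (C4 u0 u10 u4 u1) (Split
    u6 u10 (C4 u6 u10 u4 u8) (Split u9 u10 (C4 u9 u10 u4 u1) (Split u2 u10 (P7 u0 u2 u10 u4 u8 u6
    u9) (Split u3 u10 (Split u5 u10 (C4 u5 u10 u3 u6) (P7 u0 u2 u5 u6 u8 u4 u10)) (P7 u2 u0 u3 u6
    u8 u4 u10))))))) (P7 u0 u1 u9 u5 u6 u8 u7)) (P7 u5 u2 u7 u8 u4 u1 u9))))))) (P7 u1 u4 u8 u6 u5
    u2 u7)) (P7 u6 u5 u2 u0 u1 u4 u8))))))))))) (Claw u1 u0 u4 [] u7 (Split u2 u7 (C4 u2 u7 u1 u0)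
    (Split u3 u7 (C4 u3 u7 u1 u0) (Split u5 u7 (Split u6 u7 (Claw u4 u1 u1 [] u8 (Split u0 u8 (C4
    u0 u8 u4 u1) (Split u7 u8 (C4 u7 u8 u4 u1) (Split u2 u8 (Split u3 u8 (C4 u3 u8 u2 u0) (Split
    u6 u8 (Split u5 u8 (C4 u5 u8 u6 u7) (Claw u3 u0 u6 [] u9 (Split u1 u9 (C4 u1 u9 u3 u0) (Split
    u2 u9 (C4 u2 u9 u3 u0) (Split u7 u9 (C4 u7 u9 u3 u6) (Split u8 u9 (C4 u8 u9 u3 u6) (Split u4
    u9 (Split u5 u9 (Pet u0 u4 u5 u6 u7 u8 u9 u3 u2 u1) (P7 u2 u5 u7 u1 u4 u9 u3)) (Split u5 u9
    (P7 u1 u4 u8 u2 u5 u9 u3) (Claw u4 u1 u8 [] u10 (Split u0 u10 (C4 u0 u10 u4 u1) (Split u2 u10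
    (C4 u2 u10 u4 u8) (Split u6 u10 (C4 u6 u10 u4 u8) (Split u7 u10 (C4 u7 u10 u4 u1) (Split u3
    u10 (Split u5 u10 (Pet u0 u4 u5 u6 u7 u8 u10 u3 u2 u1) (P7 u2 u5 u7 u1 u4 u10 u3)) (Split u5
    u10 (P7 u0 u3 u6 u7 u5 u10 u4) (Split u9 u10 (P7 u2 u5 u7 u1 u4 u10 u9) (P7 u9 u3 u0 u2 u8 u4
    u10))))))))))))))))) (P7 u2 u8 u4 u1 u7 u6 u3))) (Split u5 u8 (Split u6 u8 (C4 u6 u8 u5 u7)
    (Split u3 u8 (Claw u2 u0 u5 [] u9 (Split u1 u9 (C4 u1 u9 u2 u0) (Split u3 u9 (C4 u3 u9 u2 u0)
    (Split u7 u9 (C4 u7 u9 u2 u5) (Split u8 u9 (C4 u8 u9 u2 u5) (Split u4 u9 (Split u6 u9 (Pet u0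
    u4 u5 u6 u7 u9 u8 u3 u2 u1) (P7 u2 u9 u4 u1 u7 u6 u3)) (Split u6 u9 (P7 u1 u4 u8 u3 u6 u9 u2)
    (Claw u4 u1 u8 [] u10 (Split u0 u10 (C4 u0 u10 u4 u1) (Split u3 u10 (C4 u3 u10 u4 u8) (Split
    u5 u10 (C4 u5 u10 u4 u8) (Split u7 u10 (C4 u7 u10 u4 u1) (Split u2 u10 (Split u6 u10 (Pet u0
    u4 u5 u6 u7 u10 u8 u3 u2 u1) (P7 u2 u10 u4 u1 u7 u6 u3)) (Split u6 u10 (P7 u0 u2 u5 u7 u6 u10
    u4) (Split u9 u10 (P7 u2 u9 u10 u4 u1 u7 u6) (P7 u9 u2 u0 u3 u8 u4 u10)))))))))))))))) (P7 u0
    u3 u6 u7 u5 u8 u4))) (Split u3 u8 (P7 u2 u5 u7 u1 u4 u8 u3) (Split u6 u8 (P7 u0 u2 u5 u7 u6 u8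
    u4) (Claw u2 u0 u5 [] u9 (Split u1 u9 (C4 u1 u9 u2 u0) (Split u3 u9 (C4 u3 u9 u2 u0) (Split u7
    u9 (C4 u7 u9 u2 u5) (Split u4 u9 (Split u6 u9 (Claw u3 u0 u6 [] u10 (Split u1 u10 (C4 u1 u10
    u3 u0) (Split u2 u10 (C4 u2 u10 u3 u0) (Split u7 u10 (C4 u7 u10 u3 u6) (Split u9 u10 (C4 u9
    u10 u3 u6) (Split u4 u10 (Split u5 u10 (Pet u0 u4 u5 u6 u7 u9 u10 u3 u2 u1) (P7 u2 u5 u7 u1 u4
    u10 u3)) (Split u5 u10 (P7 u1 u4 u9 u2 u5 u10 u3) (Split u8 u10 (P7 u2 u5 u7 u1 u4 u8 u10) (P7
    u8 u4 u1 u7 u6 u3 u10))))))))) (P7 u2 u9 u4 u1 u7 u6 u3)) (Split u8 u9 (Split u6 u9 (Claw u3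
    u0 u6 [] u10 (Split u1 u10 (C4 u1 u10 u3 u0) (Split u2 u10 (C4 u2 u10 u3 u0) (Split u7 u10 (C4
    u7 u10 u3 u6) (Split u9 u10 (C4 u9 u10 u3 u6) (Split u4 u10 (P7 u1 u4 u10 u3 u6 u9 u2) (Split
    u8 u10 (P7 u0 u1 u7 u6 u9 u8 u10) (P7 u1 u4 u8 u9 u6 u3 u10)))))))) (P7 u2 u9 u8 u4 u1 u7 u6))
    (P7 u8 u4 u1 u7 u5 u2 u9)))))))))))))) (Claw u6 u3 u3 [] u8 (Split u0 u8 (C4 u0 u8 u6 u3)
    (Split u1 u8 (Split u2 u8 (C4 u2 u8 u1 u0) (Split u5 u8 (Split u7 u8 (Claw u6 u3 u8 [] u9
    (Split u0 u9 (C4 u0 u9 u6 u3) (Split u1 u9 (C4 u1 u9 u6 u8) (Split u5 u9 (C4 u5 u9 u6 u8)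
    (Split u7 u9 (C4 u7 u9 u6 u8) (P7 u5 u7 u1 u0 u3 u6 u9)))))) (C4 u7 u1 u8 u5)) (Split u7 u8
    (Claw u2 u0 u5 [] u9 (Split u1 u9 (C4 u1 u9 u2 u0) (Split u3 u9 (C4 u3 u9 u2 u0) (Split u7 u9
    (C4 u7 u9 u2 u5) (Split u6 u9 (P7 u1 u7 u5 u2 u9 u6 u3) (Split u8 u9 (Claw u3 u0 u6 [] u10
    (Split u1 u10 (C4 u1 u10 u3 u0) (Split u2 u10 (C4 u2 u10 u3 u0) (Split u8 u10 (C4 u8 u10 u3
    u6) (Split u5 u10 (P7 u1 u8 u6 u3 u10 u5 u2) (Split u7 u10 (Split u9 u10 (C4 u9 u10 u7 u8) (P7
    u5 u2 u9 u8 u6 u3 u10)) (P7 u2 u5 u7 u8 u6 u3 u10))))))) (P7 u3 u6 u8 u7 u5 u2 u9))))))) (P7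
    u2 u5 u7 u1 u8 u6 u3)))) (Split u4 u8 (Split u7 u8 (C4 u7 u8 u4 u1) (Split u5 u8 (Split u2 u8
    (Claw u3 u0 u6 [] u9 (Split u1 u9 (C4 u1 u9 u3 u0) (Split u2 u9 (C4 u2 u9 u3 u0) (Split u8 u9
    (C4 u8 u9 u3 u6) (Split u7 u9 (P7 u1 u7 u9 u3 u6 u8 u2) (Split u4 u9 (Split u5 u9 (C4 u5 u9 u4
    u8) (P7 u0 u3 u9 u4 u8 u5 u7)) (P7 u7 u1 u4 u8 u6 u3 u9))))))) (Claw u2 u0 u5 [] u9 (Split u1
    u9 (C4 u1 u9 u2 u0) (Split u3 u9 (C4 u3 u9 u2 u0) (Split u7 u9 (C4 u7 u9 u2 u5) (Split u8 u9
    (C4 u8 u9 u2 u5) (Split u6 u9 (P7 u0 u1 u7 u5 u8 u6 u9) (Split u4 u9 (Claw u3 u0 u6 [] u10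
    (Split u1 u10 (C4 u1 u10 u3 u0) (Split u2 u10 (C4 u2 u10 u3 u0) (Split u8 u10 (C4 u8 u10 u3
    u6) (Split u4 u10 (Split u5 u10 (C4 u5 u10 u4 u8) (Split u7 u10 (C4 u7 u10 u4 u1) (P7 u0 u3
    u10 u4 u8 u5 u7))) (Split u5 u10 (Split u9 u10 (C4 u9 u10 u5 u2) (P7 u0 u3 u10 u5 u8 u4 u9))
    (P7 u4 u8 u5 u2 u0 u3 u10))))))) (P7 u4 u8 u6 u3 u0 u2 u9))))))))) (P7 u3 u6 u8 u4 u1 u7 u5)))
    (Split u5 u8 (P7 u4 u1 u0 u3 u6 u8 u5) (Split u7 u8 (Split u2 u8 (C4 u2 u8 u7 u5) (Claw u2 u0
    u5 [] u9 (Split u1 u9 (C4 u1 u9 u2 u0) (Split u3 u9 (C4 u3 u9 u2 u0) (Split u7 u9 (C4 u7 u9 u2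
    u5) (Split u6 u9 (P7 u1 u7 u5 u2 u9 u6 u3) (Split u8 u9 (Split u4 u9 (Claw u6 u3 u8 [] u10
    (Split u0 u10 (C4 u0 u10 u6 u3) (Split u7 u10 (C4 u7 u10 u6 u8) (Split u9 u10 (C4 u9 u10 u6
    u8) (Split u1 u10 (Split u2 u10 (C4 u2 u10 u1 u0) (Split u5 u10 (C4 u5 u10 u1 u7) (P7 u0 u2 u5
    u7 u8 u6 u10))) (Split u2 u10 (Split u4 u10 (C4 u4 u10 u2 u9) (P7 u0 u1 u4 u9 u8 u6 u10)) (P7
    u1 u0 u2 u9 u8 u6 u10))))))) (P7 u4 u1 u0 u2 u9 u8 u6)) (P7 u3 u6 u8 u7 u5 u2 u9)))))))) (P7
    u5 u7 u1 u0 u3 u6 u8)))))))) (Split u6 u7 (Claw u5 u2 u2 [] u8 (Split u0 u8 (C4 u0 u8 u5 u2)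
    (Split u1 u8 (Split u3 u8 (C4 u3 u8 u1 u0) (Split u6 u8 (Split u7 u8 (Claw u5 u2 u8 [] u9
    (Split u0 u9 (C4 u0 u9 u5 u2) (Split u1 u9 (C4 u1 u9 u5 u8) (Split u6 u9 (C4 u6 u9 u5 u8)
    (Split u7 u9 (C4 u7 u9 u5 u8) (P7 u6 u7 u1 u0 u2 u5 u9)))))) (C4 u7 u1 u8 u6)) (Split u7 u8
    (Claw u2 u0 u5 [] u9 (Split u1 u9 (C4 u1 u9 u2 u0) (Split u3 u9 (C4 u3 u9 u2 u0) (Split u8 u9
    (C4 u8 u9 u2 u5) (Split u6 u9 (P7 u1 u8 u5 u2 u9 u6 u3) (Split u7 u9 (Claw u3 u0 u6 [] u10
    (Split u1 u10 (C4 u1 u10 u3 u0) (Split u2 u10 (C4 u2 u10 u3 u0) (Split u7 u10 (C4 u7 u10 u3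
    u6) (Split u5 u10 (P7 u1 u7 u6 u3 u10 u5 u2) (Split u8 u10 (Split u9 u10 (C4 u9 u10 u8 u7) (P7
    u5 u2 u9 u7 u6 u3 u10)) (P7 u2 u5 u8 u7 u6 u3 u10))))))) (P7 u3 u6 u7 u8 u5 u2 u9))))))) (P7
    u2 u5 u8 u1 u7 u6 u3)))) (Split u4 u8 (Split u7 u8 (C4 u7 u8 u4 u1) (Split u6 u8 (Split u3 u8
    (Claw u2 u0 u5 [] u9 (Split u1 u9 (C4 u1 u9 u2 u0) (Split u3 u9 (C4 u3 u9 u2 u0) (Split u8 u9
    (C4 u8 u9 u2 u5) (Split u7 u9 (P7 u1 u7 u9 u2 u5 u8 u3) (Split u4 u9 (Split u6 u9 (C4 u6 u9 u4
    u8) (P7 u0 u2 u9 u4 u8 u6 u7)) (P7 u7 u1 u4 u8 u5 u2 u9))))))) (Claw u2 u0 u5 [] u9 (Split u1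
    u9 (C4 u1 u9 u2 u0) (Split u3 u9 (C4 u3 u9 u2 u0) (Split u8 u9 (C4 u8 u9 u2 u5) (Split u4 u9
    (Split u6 u9 (C4 u6 u9 u4 u8) (Split u7 u9 (C4 u7 u9 u4 u1) (P7 u0 u2 u9 u4 u8 u6 u7))) (Split
    u6 u9 (Claw u5 u2 u8 [] u10 (Split u0 u10 (C4 u0 u10 u5 u2) (Split u6 u10 (C4 u6 u10 u5 u8)
    (Split u9 u10 (C4 u9 u10 u5 u2) (Split u1 u10 (P7 u0 u1 u10 u5 u8 u6 u9) (Split u3 u10 (Split
    u7 u10 (C4 u7 u10 u3 u6) (P7 u0 u1 u7 u6 u8 u5 u10)) (P7 u1 u0 u3 u6 u8 u5 u10))))))) (P7 u4
    u8 u6 u3 u0 u2 u9)))))))) (P7 u2 u5 u8 u4 u1 u7 u6))) (Split u6 u8 (P7 u4 u1 u0 u2 u5 u8 u6)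
    (Split u7 u8 (Split u3 u8 (C4 u3 u8 u7 u6) (Claw u3 u0 u6 [] u9 (Split u1 u9 (C4 u1 u9 u3 u0)
    (Split u2 u9 (C4 u2 u9 u3 u0) (Split u7 u9 (C4 u7 u9 u3 u6) (Split u5 u9 (P7 u1 u7 u6 u3 u9 u5
    u2) (Split u8 u9 (Split u4 u9 (Claw u5 u2 u8 [] u10 (Split u0 u10 (C4 u0 u10 u5 u2) (Split u7
    u10 (C4 u7 u10 u5 u8) (Split u9 u10 (C4 u9 u10 u5 u8) (Split u1 u10 (Split u3 u10 (C4 u3 u10
    u1 u0) (Split u6 u10 (C4 u6 u10 u1 u7) (P7 u0 u3 u6 u7 u8 u5 u10))) (Split u3 u10 (Split u4
    u10 (C4 u4 u10 u3 u9) (P7 u0 u1 u4 u9 u8 u5 u10)) (P7 u1 u0 u3 u9 u8 u5 u10))))))) (P7 u4 u1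
    u0 u2 u5 u8 u9)) (P7 u2 u5 u8 u7 u6 u3 u9)))))))) (P7 u6 u7 u1 u0 u2 u5 u8))))))) (Claw u2 u0
    u5 [] u8 (Split u1 u8 (C4 u1 u8 u2 u0) (Split u3 u8 (C4 u3 u8 u2 u0) (Split u4 u8 (Split u7 u8
    (C4 u7 u8 u4 u1) (Split u6 u8 (Claw u7 u1 u1 [] u9 (Split u0 u9 (C4 u0 u9 u7 u1) (Split u4 u9
    (C4 u4 u9 u7 u1) (Split u2 u9 (Split u3 u9 (C4 u3 u9 u2 u0) (Split u6 u9 (Split u8 u9 (Claw u7
    u1 u9 [] u10 (Split u0 u10 (C4 u0 u10 u7 u1) (Split u2 u10 (C4 u2 u10 u7 u9) (Split u6 u10 (C4
    u6 u10 u7 u9) (Split u8 u10 (C4 u8 u10 u7 u9) (P7 u6 u8 u2 u0 u1 u7 u10)))))) (C4 u8 u2 u9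
    u6)) (Split u8 u9 (Claw u3 u0 u6 [] u10 (Split u1 u10 (C4 u1 u10 u3 u0) (Split u2 u10 (C4 u2
    u10 u3 u0) (Split u8 u10 (C4 u8 u10 u3 u6) (Split u7 u10 (P7 u1 u7 u10 u3 u6 u8 u2) (Split u4
    u10 (Split u9 u10 (C4 u9 u10 u4 u8) (P7 u0 u3 u10 u4 u8 u9 u7)) (P7 u7 u1 u4 u8 u6 u3
    u10))))))) (P7 u1 u7 u9 u2 u8 u6 u3)))) (Split u5 u9 (Split u8 u9 (C4 u8 u9 u5 u2) (Split u6
    u9 (P7 u0 u1 u4 u8 u6 u9 u5) (P7 u1 u7 u9 u5 u2 u8 u6))) (Split u6 u9 (P7 u5 u2 u0 u1 u7 u9
    u6) (Split u8 u9 (Split u3 u9 (C4 u3 u9 u8 u6) (Claw u3 u0 u6 [] u10 (Split u1 u10 (C4 u1 u10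
    u3 u0) (Split u2 u10 (C4 u2 u10 u3 u0) (Split u8 u10 (C4 u8 u10 u3 u6) (Split u7 u10 (P7 u1 u7
    u10 u3 u6 u8 u2) (Split u4 u10 (Split u9 u10 (C4 u9 u10 u4 u8) (P7 u0 u3 u10 u4 u8 u9 u7)) (P7
    u7 u1 u4 u8 u6 u3 u10)))))))) (P7 u5 u2 u8 u4 u1 u7 u9)))))))) (Claw u6 u3 u3 [] u9 (Split u0
    u9 (C4 u0 u9 u6 u3) (Split u1 u9 (Split u2 u9 (C4 u2 u9 u1 u0) (Split u8 u9 (Split u4 u9
    (Split u5 u9 (C4 u5 u9 u8 u2) (P7 u4 u9 u6 u3 u0 u2 u5)) (C4 u4 u1 u9 u8)) (Split u4 u9 (Split
    u5 u9 (Claw u3 u0 u6 [] u10 (Split u1 u10 (C4 u1 u10 u3 u0) (Split u2 u10 (C4 u2 u10 u3 u0)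
    (Split u9 u10 (C4 u9 u10 u3 u6) (Split u8 u10 (P7 u1 u9 u6 u3 u10 u8 u2) (Split u4 u10 (Split
    u5 u10 (C4 u5 u10 u4 u9) (P7 u5 u2 u8 u4 u10 u3 u6)) (P7 u2 u8 u4 u9 u6 u3 u10))))))) (P7 u3
    u6 u9 u4 u8 u2 u5)) (P7 u2 u8 u4 u1 u9 u6 u3)))) (Split u4 u9 (Split u7 u9 (C4 u7 u9 u4 u1)
    (Split u5 u9 (P7 u5 u9 u6 u3 u0 u1 u7) (Split u2 u9 (Split u8 u9 (P7 u7 u1 u0 u3 u6 u9 u8) (C4
    u8 u2 u9 u4)) (P7 u4 u9 u6 u3 u0 u2 u5)))) (Split u5 u9 (P7 u4 u1 u0 u3 u6 u9 u5) (Split u8 u9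
    (Split u7 u9 (Split u2 u9 (Claw u3 u0 u6 [] u10 (Split u1 u10 (C4 u1 u10 u3 u0) (Split u2 u10
    (C4 u2 u10 u3 u0) (Split u9 u10 (C4 u9 u10 u3 u6) (Split u4 u10 (P7 u1 u4 u10 u3 u6 u9 u2)
    (Split u7 u10 (Split u8 u10 (C4 u8 u10 u7 u9) (P7 u0 u3 u10 u7 u9 u8 u4)) (P7 u4 u1 u7 u9 u6
    u3 u10))))))) (P7 u5 u2 u0 u1 u7 u9 u6)) (P7 u3 u6 u9 u8 u4 u1 u7)) (P7 u8 u4 u1 u0 u3 u6
    u9))))))))) (Split u6 u8 (Split u7 u8 (Claw u4 u1 u1 [] u9 (Split u0 u9 (C4 u0 u9 u4 u1)
    (Split u7 u9 (C4 u7 u9 u4 u1) (Split u2 u9 (Split u3 u9 (C4 u3 u9 u2 u0) (Split u6 u9 (Split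
    u8 u9 (Claw u4 u1 u9 [] u10 (Split u0 u10 (C4 u0 u10 u4 u1) (Split u2 u10 (C4 u2 u10 u4 u9)
    (Split u6 u10 (C4 u6 u10 u4 u9) (Split u8 u10 (C4 u8 u10 u4 u9) (P7 u6 u8 u2 u0 u1 u4
    u10)))))) (C4 u8 u2 u9 u6)) (Split u8 u9 (Claw u3 u0 u6 [] u10 (Split u1 u10 (C4 u1 u10 u3 u0)
    (Split u2 u10 (C4 u2 u10 u3 u0) (Split u8 u10 (C4 u8 u10 u3 u6) (Split u4 u10 (P7 u1 u4 u10 u3
    u6 u8 u2) (Split u7 u10 (Split u9 u10 (C4 u9 u10 u7 u8) (P7 u0 u3 u10 u7 u8 u9 u4)) (P7 u4 u1
    u7 u8 u6 u3 u10))))))) (P7 u1 u4 u9 u2 u8 u6 u3)))) (Split u5 u9 (Split u8 u9 (C4 u8 u9 u5 u2)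
    (Split u6 u9 (P7 u0 u1 u7 u8 u6 u9 u5) (P7 u1 u4 u9 u5 u2 u8 u6))) (Split u6 u9 (P7 u5 u2 u0
    u1 u4 u9 u6) (Split u8 u9 (Split u3 u9 (C4 u3 u9 u8 u6) (Claw u3 u0 u6 [] u10 (Split u1 u10
    (C4 u1 u10 u3 u0) (Split u2 u10 (C4 u2 u10 u3 u0) (Split u8 u10 (C4 u8 u10 u3 u6) (Split u4
    u10 (P7 u1 u4 u10 u3 u6 u8 u2) (Split u7 u10 (Split u9 u10 (C4 u9 u10 u7 u8) (P7 u0 u3 u10 u7
    u8 u9 u4)) (P7 u4 u1 u7 u8 u6 u3 u10)))))))) (P7 u5 u2 u8 u7 u1 u4 u9)))))))) (Claw u4 u1 u1
    [] u9 (Split u0 u9 (C4 u0 u9 u4 u1) (Split u7 u9 (C4 u7 u9 u4 u1) (Split u2 u9 (Split u3 u9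
    (C4 u3 u9 u2 u0) (Split u6 u9 (Split u8 u9 (Claw u4 u1 u9 [] u10 (Split u0 u10 (C4 u0 u10 u4
    u1) (Split u2 u10 (C4 u2 u10 u4 u9) (Split u6 u10 (C4 u6 u10 u4 u9) (Split u8 u10 (C4 u8 u10
    u4 u9) (P7 u6 u8 u2 u0 u1 u4 u10)))))) (C4 u8 u2 u9 u6)) (Split u8 u9 (P7 u3 u6 u8 u9 u4 u1
    u7) (P7 u1 u4 u9 u2 u8 u6 u3)))) (Split u5 u9 (Split u8 u9 (C4 u8 u9 u5 u2) (P7 u7 u1 u4 u9 u5
    u2 u8)) (Split u6 u9 (P7 u5 u2 u0 u1 u4 u9 u6) (Split u8 u9 (P7 u5 u2 u8 u9 u4 u1 u7) (P7 u6
    u8 u2 u0 u1 u4 u9))))))))) (Split u7 u8 (Claw u6 u3 u3 [] u9 (Split u0 u9 (C4 u0 u9 u6 u3)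
    (Split u1 u9 (Split u2 u9 (C4 u2 u9 u1 u0) (Split u8 u9 (Split u5 u9 (C4 u5 u9 u8 u2) (Split
    u7 u9 (P7 u5 u2 u0 u3 u6 u9 u7) (C4 u7 u1 u9 u8))) (Split u7 u9 (Split u5 u9 (Claw u3 u0 u6 []
    u10 (Split u1 u10 (C4 u1 u10 u3 u0) (Split u2 u10 (C4 u2 u10 u3 u0) (Split u9 u10 (C4 u9 u10
    u3 u6) (Split u8 u10 (P7 u1 u9 u6 u3 u10 u8 u2) (Split u5 u10 (Split u7 u10 (C4 u7 u10 u5 u9)
    (P7 u0 u3 u10 u5 u9 u7 u8)) (P7 u8 u2 u5 u9 u6 u3 u10))))))) (P7 u3 u6 u9 u7 u8 u2 u5)) (P7 u2
    u8 u7 u1 u9 u6 u3)))) (Split u4 u9 (Split u7 u9 (C4 u7 u9 u4 u1) (Split u5 u9 (P7 u5 u9 u6 u3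
    u0 u1 u7) (Split u2 u9 (Split u8 u9 (Claw u3 u0 u6 [] u10 (Split u1 u10 (C4 u1 u10 u3 u0)
    (Split u2 u10 (C4 u2 u10 u3 u0) (Split u9 u10 (C4 u9 u10 u3 u6) (Split u7 u10 (P7 u1 u7 u10 u3
    u6 u9 u2) (Split u4 u10 (Split u8 u10 (C4 u8 u10 u4 u9) (P7 u0 u3 u10 u4 u9 u8 u7)) (P7 u7 u1
    u4 u9 u6 u3 u10))))))) (P7 u1 u7 u8 u2 u9 u6 u3)) (P7 u4 u9 u6 u3 u0 u2 u5)))) (Split u5 u9
    (P7 u4 u1 u0 u3 u6 u9 u5) (Split u8 u9 (P7 u4 u1 u0 u3 u6 u9 u8) (Split u7 u9 (Split u2 u9 (C4
    u2 u9 u7 u8) (P7 u3 u6 u9 u7 u8 u2 u5)) (P7 u8 u7 u1 u0 u3 u6 u9)))))))) (Claw u4 u1 u1 [] u9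
    (Split u0 u9 (C4 u0 u9 u4 u1) (Split u7 u9 (C4 u7 u9 u4 u1) (Split u2 u9 (Split u3 u9 (C4 u3
    u9 u2 u0) (Split u6 u9 (Split u5 u9 (P7 u5 u9 u6 u3 u0 u1 u7) (Split u8 u9 (P7 u7 u1 u0 u3 u6
    u9 u8) (Claw u5 u2 u2 [] u10 (Split u0 u10 (C4 u0 u10 u5 u2) (Split u8 u10 (C4 u8 u10 u5 u2)
    (Split u9 u10 (C4 u9 u10 u5 u2) (Split u1 u10 (Split u3 u10 (C4 u3 u10 u1 u0) (Split u6 u10
    (Split u7 u10 (P7 u7 u10 u6 u3 u0 u2 u8) (P7 u7 u1 u10 u6 u9 u2 u8)) (P7 u1 u10 u5 u2 u9 u6
    u3))) (Split u4 u10 (Split u7 u10 (C4 u7 u10 u4 u1) (P7 u7 u1 u4 u10 u5 u2 u8)) (Split u7 u10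
    (P7 u4 u1 u7 u10 u5 u2 u8) (P7 u7 u1 u4 u9 u2 u5 u10)))))))))) (Split u5 u9 (P7 u5 u9 u4 u1 u0
    u3 u6) (Claw u4 u1 u9 [] u10 (Split u0 u10 (C4 u0 u10 u4 u1) (Split u2 u10 (C4 u2 u10 u4 u9)
    (Split u7 u10 (C4 u7 u10 u4 u1) (Split u5 u10 (Split u8 u10 (C4 u8 u10 u5 u2) (P7 u7 u1 u4 u10
    u5 u2 u8)) (Split u6 u10 (P7 u5 u2 u0 u1 u4 u10 u6) (Split u3 u10 (P7 u5 u2 u9 u4 u10 u3 u6)
    (P7 u6 u3 u0 u2 u9 u4 u10))))))))))) (Split u5 u9 (Split u8 u9 (C4 u8 u9 u5 u2) (P7 u7 u1 u4
    u9 u5 u2 u8)) (Split u8 u9 (P7 u5 u2 u8 u9 u4 u1 u7) (Claw u5 u2 u2 [] u10 (Split u0 u10 (C4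
    u0 u10 u5 u2) (Split u8 u10 (C4 u8 u10 u5 u2) (Split u1 u10 (Split u3 u10 (C4 u3 u10 u1 u0)
    (Split u6 u10 (Split u4 u10 (P7 u4 u10 u6 u3 u0 u2 u8) (Split u9 u10 (C4 u9 u10 u1 u4) (P7 u8
    u2 u5 u10 u1 u4 u9))) (Split u4 u10 (P7 u4 u10 u5 u2 u0 u3 u6) (Split u9 u10 (C4 u9 u10 u1 u4)
    (P7 u8 u2 u5 u10 u1 u4 u9))))) (Split u4 u10 (Split u7 u10 (C4 u7 u10 u4 u1) (P7 u7 u1 u4 u10
    u5 u2 u8)) (Split u9 u10 (P7 u1 u4 u9 u10 u5 u2 u8) (P7 u9 u4 u1 u0 u2 u5
    u10))))))))))))))))))))))))))))))))))))))"

lemma claw_check: "check True [] [u0, u1] (add u0 u1 True []) [(u0, u1)] claw_cert"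
  unfolding claw_cert_def by code_simp

theorem theorem1p3:
  fixes V :: "'a set" and E :: "'a \<Rightarrow> 'a \<Rightarrow> bool"
  assumes "simple_graph V E"
    and "connected_graph V E"
    and "H_free V E (path_V 7) (path_E 7)"
    and "H_free V E (cycle_V 4) (cycle_E 4)"
    and "H_free V E gem_V gem_E"
    and "\<not> has_clique_cutset V E"
    and "\<not> clique_blowup V E petersen_V petersen_E"
  shows "\<exists>v\<in>V. bisimplicial V E v"
proof (rule ccontr)
  assume "\<not> ?thesis"
  then have nb: "\<not> bisimplicial V E v" if "v \<in> V" for v using that by blast
  interpret forbidding V E using assms by unfold_locales
  \<comment> \<open>If the hull is all of \<open>V\<close>, the graph is a blowup of the Petersen
    graph; otherwise an outside vertex yields a clique cutset.\<close>
  have "\<not> emb f" for f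
  proof
    assume f: "emb f"
    then obtain x where "x \<in> V" "x \<notin> hull f" using hull_blowup[OF f] assms(7) by blast
    then show False using hull_clique_cutset[OF f assms(2)] assms(6) by blast
  qed
  then have no_petersen: "\<not> holds f (petersen a b c d e g h i j k)" for f :: "name \<Rightarrow> 'a" and a b c d e g h i j k
    using holds_petersen_emb by blast
  obtain v where v: "v \<in> V" using assms(2) unfolding connected_graph_def by blast
  then obtain w where vw: "good v w" using ex_good nb by blast
  then have edge: "E v w" unfolding good_def by blast
  \<comment> \<open>Only \<open>u0\<close> and \<open>u1\<close> are in use at the root;
    \<open>w\<close> is a default for all further names.\<close>
  define f where "f = (\<lambda>n. if n = u0 then v else w)"
  have ne: "v \<noteq> w" using edge irrefl by blast
  have "model f [u0, u1] [] [(u0, u1)]"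
    unfolding model_def using vw ne by (simp add: f_def holds_Nil)
  then have "model f [u0, u1] (add u0 u1 True []) [(u0, u1)]"
    by (rule model_add) (use edge in \<open>simp_all add: f_def\<close>)
  from check_refutes[OF claw_check this _ _ nb no_petersen] show False by simp
qed

end
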